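(* Let $\Gamma$ be a finitely generated non-amenable group. Then there exists a finite symmetric set of generators $S$ of $\Gamma$ such that $p_c(\Gamma,S) < p_u(\Gamma,S)$.
   Context: Groups are discrete. A subset $S \subset \Gamma$ is symmetric if $S^{-1}=S$. The Cayley graph of $\Gamma$ with respect to $S$ is the simple graph with vertex set $\Gamma$ and edges $\{g,gs\}$ for $g \in \Gamma$, $s \in S$, $s \neq e$. In Bernoulli($p$) bond percolation on this graph, each edge is independently kept (open) with probability $p \in [0,1]$ and deleted otherwise; clusters are the connected components of the resulting random subgraph. $p_c(\Gamma,S)$ is the infimum of all $p \in [0,1]$ such that Bernoulli($p$) bond percolation on the Cayley graph almost surely has an infinite cluster, and $p_u(\Gamma,S)$ is the infimum of all $p \in [0,1]$ such that it almost surely has exactly one infinite cluster. *)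

theory Defs
  imports "HOL-Algebra.Generated_Groups" "HOL-Probability.Probability"
begin

definition finitely_generated :: "('a, 'b) monoid_scheme \<Rightarrow> bool" where
  "finitely_generated G \<longleftrightarrow>
     (\<exists>S. finite S \<and> S \<subseteq> carrier G \<and> generate G S = carrier G)"

text \<open>
  Amenability of a discrete group in the sense of von Neumann: there is a left-invariant, finitely
  additive probability measure defined on all subsets of the group.
\<close>

definition amenable :: "('a, 'b) monoid_scheme \<Rightarrow> bool" where
  "amenable G \<longleftrightarrow>
     (\<exists>m :: 'a set \<Rightarrow> real.
        (\<forall>A. A \<subseteq> carrier G \<longrightarrow> 0 \<le> m A) \<and>
        m (carrier G) = 1 \<and>
        (\<forall>A B. A \<subseteq> carrier G \<longrightarrow> B \<subseteq> carrier G \<longrightarrow> A \<inter> B = {} \<longrightarrow> m (A \<union> B) = m A + m B) \<and>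
        (\<forall>g A. g \<in> carrier G \<longrightarrow> A \<subseteq> carrier G \<longrightarrow> m (g <#\<^bsub>G\<^esub> A) = m A))"

definition finite_symmetric_generating_set :: "('a, 'b) monoid_scheme \<Rightarrow> 'a set \<Rightarrow> bool" where
  "finite_symmetric_generating_set G S \<longleftrightarrow>
     finite S \<and> S \<subseteq> carrier G \<and> set_inv\<^bsub>G\<^esub> S = S \<and> generate G S = carrier G"

text \<open>
  An undirected simple graph is given by a vertex set and a set of two-element sets of vertices.
  As edges are sets, \<open>{g, gs}\<close> and \<open>{gs, (gs)s\<inverse>}\<close> are one edge, with a single state in percolation.
\<close>

definition cayley_edges :: "('a, 'b) monoid_scheme \<Rightarrow> 'a set \<Rightarrow> 'a set set" where
  "cayley_edges G S = {{g, g \<otimes>\<^bsub>G\<^esub> s} |g s. g \<in> carrier G \<and> s \<in> S \<and> s \<noteq> \<one>\<^bsub>G\<^esub>}"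

definition clusters :: "'a set \<Rightarrow> 'a set set \<Rightarrow> 'a set set" where
  "clusters V F = V // {(x, y) \<in> V \<times> V. (x, y) \<in> {(u, v). {u, v} \<in> F}\<^sup>*}"

definition bernoulli_percolation :: "'e set \<Rightarrow> real \<Rightarrow> ('e \<Rightarrow> bool) measure" where
  "bernoulli_percolation E p = (\<Pi>\<^sub>M e\<in>E. measure_pmf (bernoulli_pmf p))"

definition cayley_clusters ::
  "('a, 'b) monoid_scheme \<Rightarrow> 'a set \<Rightarrow> ('a set \<Rightarrow> bool) \<Rightarrow> 'a set set" where
  "cayley_clusters G S \<omega> = clusters (carrier G) {e \<in> cayley_edges G S. \<omega> e}"

text \<open>
  If \<open>G\<close> is infinite and \<open>S\<close> is a finite generating set, then both sets below contain \<open>1\<close>, so the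
  infima are taken over nonempty bounded sets.
\<close>

definition p_c :: "('a, 'b) monoid_scheme \<Rightarrow> 'a set \<Rightarrow> real" where
  "p_c G S = Inf {p \<in> {0..1}. AE \<omega> in bernoulli_percolation (cayley_edges G S) p.
     \<exists>C. C \<in> cayley_clusters G S \<omega> \<and> infinite C}"

definition p_u :: "('a, 'b) monoid_scheme \<Rightarrow> 'a set \<Rightarrow> real" where
  "p_u G S = Inf {p \<in> {0..1}. AE \<omega> in bernoulli_percolation (cayley_edges G S) p.
     \<exists>!C. C \<in> cayley_clusters G S \<omega> \<and> infinite C}"

end

theory Submission
  imports Defs "HOL-Real_Asymp.Real_Asymp"
begin

text \<open>
  The proof compares two bounds, both governed by one number: an upper bound \<open>c\<close> for the \<open>l\<^sup>2\<close> operator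
  norm of convolution with the indicator function of a finite symmetric generating set \<open>S\<close>, whose size
  is written \<open>d\<close>.

  Above: by definition of the operator norm, at most \<open>c ^ n\<close> words of length \<open>n\<close> in \<open>S\<close> represent a given
  group element. Hence for \<open>p * c < 1\<close> the probability that \<open>x\<close> and \<open>y\<close> are connected decays
  geometrically in their distance (\<open>prob_conn_le\<close>). If there were almost surely a unique infinite
  cluster, then a large finite set \<open>B\<close> and, by translation invariance, each of its translates would meet
  it with probability above 3/4. So \<open>B\<close> and \<open>gB\<close> would be connected with probability at least 1/2 for
  every \<open>g\<close>, which is false for \<open>g\<close> far away (\<open>not_AE_unique_infinite_cluster\<close>). Thus \<open>p\<^sub>u \<ge> 1 / c\<close>.

  Below: the same norm bound gives every finite vertex set \<open>C\<close> at least \<open>(d - c) * card C\<close> boundary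
  edges, while at most \<open>d ^ (2 * n)\<close> connected sets of size \<open>n\<close> contain the identity. If \<open>c \<le> d / 2\<close>, a
  Peierls argument gives an infinite cluster as soon as \<open>p * d \<ge> 4 * ln d + 2\<close>
  (\<open>AE_infinite_cluster\<close>). Thus \<open>p\<^sub>c \<le> (4 * ln d + 2) / d\<close>.

  It remains to find \<open>S\<close> for which \<open>c * ln d / d\<close> is small (\<open>sparse_generating_set\<close>). Start from any
  finite symmetric generating set \<open>T\<close>. Non-amenability gives a linear isoperimetric inequality (the
  contrapositive of \<open>amenable_if_folner\<close>), and Cheeger's inequality turns it into a norm \<open>r < card T\<close>
  for \<open>T\<close>. The function counting words of length \<open>k\<close> has norm at most \<open>r ^ k\<close> and total mass
  \<open>card T ^ k\<close>. Cut its support into dyadic level sets. There are only \<open>O(k)\<close> of them, so one of them,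
  \<open>A\<close>, carries a fraction of order \<open>1 / k\<close> of the mass. As the function is nearly constant on \<open>A\<close>, the
  norm of the indicator of \<open>A\<close> is at most \<open>card A\<close> times \<open>O(k) * (r / card T) ^ k\<close>
  (\<open>dense_level_set\<close>). This decays exponentially in \<open>k\<close>, whereas \<open>ln (card A)\<close> grows only linearly;
  so \<open>S\<close>, the union of \<open>A\<close>, its inverses and \<open>T\<close>, works for large \<open>k\<close>. Passing to a level set is what
  yields a set rather than a multiset of generators.
\<close>

section \<open>From almost invariant finite sets to invariant means\<close>

text \<open>
  Set functions with values in \<open>{0..1}\<close> form a compact space by Tychonoff's theorem. The sequence
  therefore has a cluster point, and a filter below \<^const>\<open>sequentially\<close> converges to it in all
  coordinates at once; it serves as a generalised limit.
\<close>

lemma compact_sequence_limit_filter: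
  fixes m :: "nat \<Rightarrow> 'a set \<Rightarrow> real"
  assumes m01: "\<And>n A. m n A \<in> {0..1}"
  obtains \<mu> L where "L \<noteq> bot" "L \<le> sequentially" "\<And>A. ((\<lambda>n. m n A) \<longlongrightarrow> \<mu> A) L"
proof -
  define U where "U = PiE UNIV (\<lambda>_::'a set. {0..1::real})"
  have "compactin (product_topology (\<lambda>_. euclidean) UNIV) U"
    unfolding U_def by (subst compactin_PiE) auto
  then have "compact U"
    by (simp add: euclidean_product_topology)
  moreover have "eventually (\<lambda>x. x \<in> U) (filtermap m sequentially)"
    unfolding eventually_filtermap U_def using m01 by (intro always_eventually allI PiE_I) auto
  ultimately obtain \<mu> where \<mu>: "inf (nhds \<mu>) (filtermap m sequentially) \<noteq> bot"
    unfolding compact_filter by (metis filtermap_bot_iff sequentially_bot)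
  define L where "L = inf (filtercomap m (nhds \<mu>)) sequentially"
  have "L \<noteq> bot"
  proof
    assume "L = bot"
    then have "eventually (\<lambda>_. False) L" by simp
    then obtain P Q where P: "eventually P (filtercomap m (nhds \<mu>))" and Q: "eventually Q sequentially"
      and PQ: "\<And>x. P x \<and> Q x \<Longrightarrow> False"
      unfolding L_def eventually_inf by blast
    then obtain R where R: "eventually R (nhds \<mu>)" "\<And>x. R (m x) \<Longrightarrow> P x"
      by (auto simp: eventually_filtercomap)
    have "eventually (\<lambda>y. \<not> R y) (filtermap m sequentially)"
      unfolding eventually_filtermap using Q by eventually_elim (use R PQ in blast)
    with R(1) have "eventually (\<lambda>_. False) (inf (nhds \<mu>) (filtermap m sequentially))"
      unfolding eventually_inf by blast
    with \<mu> show False by simp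
  qed
  moreover have "L \<le> sequentially" by (simp add: L_def)
  moreover have "((\<lambda>n. m n A) \<longlongrightarrow> \<mu> A) L" for A
  proof -
    have lim: "filterlim m (nhds \<mu>) L"
      by (rule filterlim_mono[OF filterlim_filtercomap order_refl]) (simp add: L_def)
    show ?thesis
    proof (rule topological_tendstoI)
      fix V :: "real set" assume V: "open V" "\<mu> A \<in> V"
      have "open ((\<lambda>x. x A) -` V)"
        by (rule open_vimage[OF V(1)]) simp
      then have "eventually (\<lambda>x. x \<in> (\<lambda>x. x A) -` V) (nhds \<mu>)"
        using V(2) by (intro eventually_nhds_in_open) auto
      with lim show "eventually (\<lambda>n. m n A \<in> V) L"
        by (auto simp: filterlim_iff)
    qed
  qed
  ultimately show ?thesis by (rule that)
qed

context group
begin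

text \<open>
  The directed edges that leave \<open>F\<close> in the Cayley graph, where generators act by multiplication on the right.
\<close>

definition out_pairs :: "'a set \<Rightarrow> 'a set \<Rightarrow> ('a \<times> 'a) set" where
  "out_pairs T F = {(x, t) \<in> F \<times> T. x \<otimes> t \<notin> F}"

lemma finite_out_pairs: "finite T \<Longrightarrow> finite F \<Longrightarrow> finite (out_pairs T F)"
  by (rule finite_subset[of _ "F \<times> T"]) (auto simp: out_pairs_def)

text \<open>
  Let \<open>F n\<close> be finite sets whose boundary is at most a fraction \<open>1 / (n + 1)\<close> of their size. The mean is
  a generalised limit of the proportions of \<open>x \<in> F n\<close> with \<open>inv x \<in> A\<close>. The inverse exchanges the two
  sides: right multiplication nearly preserves \<open>F n\<close>, while the mean has to be invariant under left
  translation. Invariance under generators extends to the group that they generate.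
\<close>

lemma amenable_if_folner:
  assumes T: "finite T" "T \<subseteq> carrier G" "generate G T = carrier G" "\<And>t. t \<in> T \<Longrightarrow> inv t \<in> T"
    and folner: "\<And>\<epsilon>::real. \<epsilon> > 0 \<Longrightarrow>
      \<exists>F. finite F \<and> F \<noteq> {} \<and> F \<subseteq> carrier G \<and> card (out_pairs T F) < \<epsilon> * card F"
  shows "amenable G"
proof -
  have "\<forall>n. \<exists>F. finite F \<and> F \<noteq> {} \<and> F \<subseteq> carrier G \<and> card (out_pairs T F) < (1 / Suc n) * card F"
    by (intro allI folner) simp
  then obtain F where F: "\<And>n. finite (F n)" "\<And>n. F n \<noteq> {}" "\<And>n. F n \<subseteq> carrier G"
    "\<And>n. card (out_pairs T (F n)) < (1 / Suc n) * card (F n)" by metis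
  have Fpos: "real (card (F n)) > 0" for n using F by (simp add: card_gt_0_iff)
  define m where "m n A = card {x \<in> F n. inv x \<in> A} / card (F n)" for n A
  have "m n A \<in> {0..1}" for n A
    using F(1)[of n] Fpos[of n] by (auto simp: m_def divide_simps intro!: card_mono)
  then obtain \<mu> L where L: "L \<noteq> bot" "L \<le> sequentially" "\<And>A. ((\<lambda>n. m n A) \<longlongrightarrow> \<mu> A) L"
    using compact_sequence_limit_filter[of m] by metis
  have pos: "0 \<le> \<mu> A" for A
    by (rule tendsto_lowerbound[OF L(3) _ L(1)]) (simp add: m_def)
  have one: "\<mu> (carrier G) = 1"
  proof -
    have "{x \<in> F n. inv x \<in> carrier G} = F n" for n using F(3)[of n] by auto
    then have "m n (carrier G) = 1" for n using Fpos[of n] by (simp add: m_def)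
    then show ?thesis using L(3)[of "carrier G"] L(1) by (simp add: tendsto_const_iff)
  qed
  have add: "\<mu> (A \<union> B) = \<mu> A + \<mu> B" if "A \<inter> B = {}" for A B
  proof -
    have "m n (A \<union> B) = m n A + m n B" for n
    proof -
      have "{x \<in> F n. inv x \<in> A \<union> B} = {x \<in> F n. inv x \<in> A} \<union> {x \<in> F n. inv x \<in> B}" by auto
      moreover have "card \<dots> = card {x \<in> F n. inv x \<in> A} + card {x \<in> F n. inv x \<in> B}"
        using F(1)[of n] that by (intro card_Un_disjoint) auto
      ultimately show ?thesis by (simp add: m_def add_divide_distrib)
    qed
    then have "((\<lambda>n. m n A + m n B) \<longlongrightarrow> \<mu> (A \<union> B)) L" using L(3)[of "A \<union> B"] by simp
    moreover have "((\<lambda>n. m n A + m n B) \<longlongrightarrow> \<mu> A + \<mu> B) L" by (intro tendsto_intros L)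
    ultimately show ?thesis using tendsto_unique L(1) by blast
  qed
  have le: "\<mu> (t <# A) \<le> \<mu> A" if t: "t \<in> T" and A: "A \<subseteq> carrier G" for t A
  proof -
    have tc: "t \<in> carrier G" using t T by auto
    have "m n (t <# A) \<le> m n A + 1 / Suc n" for n
    proof -
      let ?X = "{x \<in> F n. inv x \<in> t <# A}"
      \<comment> \<open>Apart from the points that right multiplication by \<open>t\<close> takes out of \<open>F n\<close>, it maps the points counted for \<open>tA\<close> injectively to points counted for \<open>A\<close>.\<close>
      have sub: "(\<lambda>x. x \<otimes> t) ` {x \<in> ?X. x \<otimes> t \<in> F n} \<subseteq> {x \<in> F n. inv x \<in> A}"
      proof safe
        fix x assume x: "x \<in> F n" "inv x \<in> t <# A" "x \<otimes> t \<in> F n"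
        then obtain a where a: "a \<in> A" "inv x = t \<otimes> a" by (auto simp: l_coset_def)
        have xc: "x \<in> carrier G" "a \<in> carrier G" using x F(3)[of n] a A by auto
        have "inv (x \<otimes> t) = inv t \<otimes> (t \<otimes> a)" using xc tc a by (simp add: inv_mult_group)
        also have "\<dots> = a" using xc tc by (simp add: m_assoc[symmetric])
        finally show "inv (x \<otimes> t) \<in> A" using a by simp
      qed
      have inj: "inj_on (\<lambda>x. x \<otimes> t) (F n)"
        using F(3)[of n] tc by (auto simp: inj_on_def subset_iff)
      have "card {x \<in> ?X. x \<otimes> t \<in> F n} = card ((\<lambda>x. x \<otimes> t) ` {x \<in> ?X. x \<otimes> t \<in> F n})"
        by (rule card_image[symmetric]) (rule inj_on_subset[OF inj], auto)
      also have "\<dots> \<le> card {x \<in> F n. inv x \<in> A}"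
        by (rule card_mono[OF _ sub]) (use F(1) in auto)
      finally have c1: "card {x \<in> ?X. x \<otimes> t \<in> F n} \<le> card {x \<in> F n. inv x \<in> A}" .
      have "card {x \<in> ?X. x \<otimes> t \<notin> F n} = card ((\<lambda>x. (x, t)) ` {x \<in> ?X. x \<otimes> t \<notin> F n})"
        by (rule card_image[symmetric]) (auto simp: inj_on_def)
      also have "\<dots> \<le> card (out_pairs T (F n))"
        by (rule card_mono[OF finite_out_pairs]) (use F(1)[of n] T(1) t in \<open>auto simp: out_pairs_def\<close>)
      finally have c2: "card {x \<in> ?X. x \<otimes> t \<notin> F n} \<le> card (out_pairs T (F n))" .
      have "card ?X = card ({x \<in> ?X. x \<otimes> t \<in> F n} \<union> {x \<in> ?X. x \<otimes> t \<notin> F n})"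
        by (rule arg_cong[of _ _ card]) auto
      also have "\<dots> \<le> card {x \<in> ?X. x \<otimes> t \<in> F n} + card {x \<in> ?X. x \<otimes> t \<notin> F n}"
        by (rule card_Un_le)
      also have "\<dots> \<le> card {x \<in> F n. inv x \<in> A} + card (out_pairs T (F n))" using c1 c2 by simp
      finally have "real (card ?X) \<le> card {x \<in> F n. inv x \<in> A} + (1 / Suc n) * card (F n)"
        using F(4)[of n] by linarith
      then have "card ?X / card (F n) \<le> (card {x \<in> F n. inv x \<in> A} + (1 / Suc n) * card (F n)) / card (F n)"
        using Fpos[of n] by (intro divide_right_mono) auto
      then show ?thesis using Fpos[of n] by (simp add: m_def add_divide_distrib)
    qed
    moreover have "((\<lambda>n. m n A + 1 / Suc n) \<longlongrightarrow> \<mu> A + 0) L"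
      by (intro tendsto_add L tendsto_mono[OF L(2)] LIMSEQ_Suc[OF lim_1_over_n])
    ultimately show ?thesis using tendsto_le[OF L(1) _ L(3)] by force
  qed
  have mult: "g <# (h <# A) = (g \<otimes> h) <# A" if "g \<in> carrier G" "h \<in> carrier G" "A \<subseteq> carrier G" for g h A
    using that by (simp add: lcos_m_assoc)
  have inT: "\<mu> (t <# A) = \<mu> A" if t: "t \<in> T" and A: "A \<subseteq> carrier G" for t A
  proof (rule antisym)
    show "\<mu> (t <# A) \<le> \<mu> A" by (rule le[OF t A])
    have tc: "t \<in> carrier G" using t T by auto
    have "A = inv t <# (t <# A)" using mult[of "inv t" t A] tc A by (simp add: lcos_mult_one)
    then show "\<mu> A \<le> \<mu> (t <# A)"
      using le[OF T(4)[OF t], of "t <# A"] l_coset_subset_G[OF A tc] by simp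
  qed
  have all: "\<mu> (g <# A) = \<mu> A" if g: "g \<in> generate G T" and A: "A \<subseteq> carrier G" for g A
    using g A
  proof (induction arbitrary: A rule: generate.induct)
    case one then show ?case by (simp add: lcos_mult_one)
  next
    case (incl h) then show ?case using inT by simp
  next
    case (inv h) then show ?case using inT T(4) by simp
  next
    case (eng g h)
    have "g \<in> carrier G" "h \<in> carrier G" using eng.hyps T(3) by auto
    then show ?case
      using eng.IH(1)[of "h <# A"] eng.IH(2)[of A] eng.prems mult[of g h A]
        l_coset_subset_G[of A h] by simp
  qed
  show ?thesis unfolding amenable_def
    using pos one add all T(3) by (intro exI[of _ \<mu>]) auto
qed

lemma isoperimetric_if_not_amenable:
  assumes T: "finite T" "T \<subseteq> carrier G" "generate G T = carrier G" "\<And>t. t \<in> T \<Longrightarrow> inv t \<in> T"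
    and "\<not> amenable G"
  obtains h :: real where "h > 0"
    "\<And>F. finite F \<Longrightarrow> F \<subseteq> carrier G \<Longrightarrow> h * card F \<le> card (out_pairs T F)"
proof -
  have "\<exists>h::real > 0. \<forall>F. finite F \<and> F \<noteq> {} \<and> F \<subseteq> carrier G \<longrightarrow> h * card F \<le> card (out_pairs T F)"
  proof (rule ccontr)
    assume neg: "\<not> ?thesis"
    have "amenable G"
    proof (rule amenable_if_folner[OF T])
      fix \<epsilon> :: real assume "\<epsilon> > 0"
      then show "\<exists>F. finite F \<and> F \<noteq> {} \<and> F \<subseteq> carrier G \<and> card (out_pairs T F) < \<epsilon> * card F"
        using neg by (simp add: not_le)
    qed
    with assms(5) show False by contradiction
  qed
  then obtain h :: real where h: "h > 0"
    "\<And>F. finite F \<Longrightarrow> F \<noteq> {} \<Longrightarrow> F \<subseteq> carrier G \<Longrightarrow> h * card F \<le> card (out_pairs T F)"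
    by blast
  have "h * card F \<le> card (out_pairs T F)" if "finite F" "F \<subseteq> carrier G" for F
    using that h(2)[of F] by (cases "F = {}") simp_all
  with h(1) show ?thesis by (rule that)
qed

end

section \<open>Isoperimetry and Cheeger's inequality\<close>

text \<open>
  Polarisation. For a symmetric non-negative kernel, four times the value of the form at \<open>f, g\<close> is its
  diagonal value at \<open>f + g\<close> minus that at \<open>f - g\<close>; the second is at least minus the diagonal value at
  \<open>\<bar>f - g\<bar>\<close>. This bounds the form by the arithmetic mean of the squared norms, and normalising \<open>f\<close> and
  \<open>g\<close> turns that into their product.
\<close>

lemma symmetric_form_bound:
  fixes K :: "'a \<Rightarrow> 'a \<Rightarrow> real"
  assumes Z: "finite Z"
    and sym: "\<And>x y. x \<in> Z \<Longrightarrow> y \<in> Z \<Longrightarrow> K x y = K y x"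
    and nn: "\<And>x y. 0 \<le> K x y"
    and diag: "\<And>f. (\<And>x. 0 \<le> f x) \<Longrightarrow> (\<Sum>x\<in>Z. \<Sum>y\<in>Z. K x y * f x * f y) \<le> r * (\<Sum>x\<in>Z. (f x)\<^sup>2)"
    and f: "\<And>x. 0 \<le> f x" and g: "\<And>x. 0 \<le> g x"
  shows "(\<Sum>x\<in>Z. \<Sum>y\<in>Z. K x y * f x * g y) \<le> r * L2_set f Z * L2_set g Z"
proof -
  define B where "B f g = (\<Sum>x\<in>Z. \<Sum>y\<in>Z. K x y * f x * g y)" for f g
  define N where "N f = (\<Sum>x\<in>Z. (f x)\<^sup>2)" for f :: "'a \<Rightarrow> real"
  have amgm: "2 * B f g \<le> r * (N f + N g)" if f: "\<And>x. 0 \<le> f x" and g: "\<And>x. 0 \<le> g x" for f g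
  proof -
    have swap: "B g f = B f g"
      unfolding B_def by (subst sum.swap) (intro sum.cong refl, simp add: sym mult_ac)
    let ?d = "\<lambda>x. \<bar>f x - g x\<bar>" and ?s = "\<lambda>x. f x + g x"
    have "4 * B f g = (B f f + B f g + B g f + B g g) - (B f f - B f g - B g f + B g g)"
      by (simp add: swap)
    also have "B f f + B f g + B g f + B g g = B ?s ?s"
      by (simp add: B_def sum.distrib algebra_simps)
    also have "B f f - B f g - B g f + B g g = B (\<lambda>x. f x - g x) (\<lambda>x. f x - g x)"
      by (simp add: B_def sum.distrib sum_subtractf algebra_simps)
    also have "B ?s ?s - B (\<lambda>x. f x - g x) (\<lambda>x. f x - g x) \<le> B ?s ?s + B ?d ?d"
    proof -
      have "- B (\<lambda>x. f x - g x) (\<lambda>x. f x - g x) = (\<Sum>x\<in>Z. \<Sum>y\<in>Z. K x y * (- ((f x - g x) * (f y - g y))))"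
        unfolding B_def sum_negf[symmetric] by (intro sum.cong refl) (simp add: algebra_simps)
      also have "\<dots> \<le> (\<Sum>x\<in>Z. \<Sum>y\<in>Z. K x y * \<bar>(f x - g x) * (f y - g y)\<bar>)"
        by (intro sum_mono mult_left_mono nn) linarith
      also have "\<dots> = B ?d ?d" by (simp add: B_def abs_mult mult_ac)
      finally show ?thesis by linarith
    qed
    also have "\<dots> \<le> r * N ?s + r * N ?d"
      unfolding B_def N_def using f g by (intro add_mono diag) auto
    also have "\<dots> = r * (N ?s + N ?d)" by (simp add: algebra_simps)
    also have "N ?s + N ?d = 2 * (N f + N g)"
      by (simp add: N_def sum.distrib[symmetric] sum_distrib_left power2_eq_square algebra_simps)
    finally show ?thesis by (simp add: algebra_simps)
  qed
  have L2: "(L2_set f Z)\<^sup>2 = N f" for f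
    by (simp add: L2_set_def N_def sum_nonneg)
  consider "L2_set f Z = 0" | "L2_set g Z = 0" | "L2_set f Z > 0" "L2_set g Z > 0"
    using L2_set_nonneg[of f Z] L2_set_nonneg[of g Z] by linarith
  then show ?thesis
  proof cases
    case 1
    then have "\<forall>x\<in>Z. f x = 0" using Z by (simp add: L2_set_eq_0_iff)
    then show ?thesis using 1 by simp
  next
    case 2
    then have "\<forall>x\<in>Z. g x = 0" using Z by (simp add: L2_set_eq_0_iff)
    then show ?thesis using 2 by simp
  next
    case 3
    let ?a = "L2_set f Z" and ?b = "L2_set g Z"
    have Nn: "N (\<lambda>x. f x / L2_set f Z) = 1" if "L2_set f Z > 0" for f
    proof -
      have "N (\<lambda>x. f x / L2_set f Z) = N f / (L2_set f Z)\<^sup>2"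
        by (simp add: N_def power_divide sum_divide_distrib)
      also have "\<dots> = 1" using that unfolding L2[symmetric] by simp
      finally show ?thesis .
    qed
    have "2 * B (\<lambda>x. f x / ?a) (\<lambda>x. g x / ?b) \<le> r * (1 + 1)"
      using amgm[of "\<lambda>x. f x / ?a" "\<lambda>x. g x / ?b"] f g 3 by (simp add: Nn L2_set_nonneg)
    moreover have "B (\<lambda>x. f x / ?a) (\<lambda>x. g x / ?b) = B f g / (?a * ?b)"
      by (simp add: B_def sum_divide_distrib)
    ultimately have "B f g / (?a * ?b) \<le> r" by simp
    then show ?thesis using 3 by (simp add: B_def divide_le_eq mult.assoc)
  qed
qed

context group
begin

text \<open>
  The isoperimetric inequality, read as a statement about indicator functions, extends to all finitely
  supported non-negative functions by layers: subtract the minimum \<open>m\<close> of \<open>u\<close> on \<open>X\<close>. The layer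
  contributes \<open>m\<close> for each pair leaving \<open>X\<close>, and what remains has smaller support.
\<close>

lemma coarea_inequality:
  fixes h :: real
  assumes T: "finite T"
    and iso: "\<And>F. finite F \<Longrightarrow> F \<subseteq> carrier G \<Longrightarrow> h * card F \<le> card (out_pairs T F)"
    and X: "finite X" "X \<subseteq> carrier G"
    and u: "\<And>x. 0 \<le> u x" "\<And>x. x \<notin> X \<Longrightarrow> u x = 0"
  shows "h * (\<Sum>x\<in>X. u x) \<le> (\<Sum>x\<in>X. \<Sum>t\<in>T. max 0 (u x - u (x \<otimes> t)))"
  using X u
proof (induction X arbitrary: u rule: finite_psubset_induct)
  case (psubset X)
  show ?case
  proof (cases "X = {}")
    case False
    define m where "m = Min (u ` X)"
    have m: "0 \<le> m" "\<And>x. x \<in> X \<Longrightarrow> m \<le> u x"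
      unfolding m_def using psubset.hyps False psubset.prems(2) by auto
    have "m \<in> u ` X" unfolding m_def using psubset.hyps False by (intro Min_in) auto
    then obtain x0 where x0: "x0 \<in> X" "u x0 = m" by auto
    define v where "v x = (if x \<in> X then u x - m else 0)" for x
    define X' where "X' = {x \<in> X. u x > m}"
    have X': "X' \<subset> X" using x0 by (auto simp: X'_def)
    have v0: "0 \<le> v x" for x using m by (auto simp: v_def)
    have v1: "v x = 0" if "x \<notin> X'" for x using that m(2)[of x] by (auto simp: v_def X'_def)
    have IH: "h * (\<Sum>x\<in>X'. v x) \<le> (\<Sum>x\<in>X'. \<Sum>t\<in>T. max 0 (v x - v (x \<otimes> t)))"
      using X' v0 v1 psubset.prems(1) by (intro psubset.IH) auto
    have e1: "(\<Sum>x\<in>X'. v x) = (\<Sum>x\<in>X. v x)"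
      using X' psubset.hyps v1 by (intro sum.mono_neutral_left) auto
    have e2: "(\<Sum>x\<in>X'. \<Sum>t\<in>T. max 0 (v x - v (x \<otimes> t))) = (\<Sum>x\<in>X. \<Sum>t\<in>T. max 0 (v x - v (x \<otimes> t)))"
      using X' psubset.hyps v1 v0 by (intro sum.mono_neutral_left) auto
    have e3: "(\<Sum>x\<in>X. \<Sum>t\<in>T. if x \<otimes> t \<notin> X then m else 0) = m * card (out_pairs T X)"
    proof -
      have "(\<Sum>x\<in>X. \<Sum>t\<in>T. if x \<otimes> t \<notin> X then m else 0)
          = (\<Sum>z\<in>X \<times> T. if fst z \<otimes> snd z \<notin> X then m else 0)"
        by (simp add: sum.cartesian_product case_prod_unfold)
      also have "\<dots> = (\<Sum>z\<in>{z \<in> X \<times> T. fst z \<otimes> snd z \<notin> X}. m)"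
        using psubset.hyps T by (subst sum.inter_filter) auto
      also have "{z \<in> X \<times> T. fst z \<otimes> snd z \<notin> X} = out_pairs T X"
        by (auto simp: out_pairs_def)
      finally show ?thesis by (simp add: mult.commute)
    qed
    have "h * (\<Sum>x\<in>X. u x) = h * (\<Sum>x\<in>X. v x) + m * (h * card X)"
      by (simp add: v_def sum_subtractf algebra_simps)
    also have "\<dots> \<le> (\<Sum>x\<in>X. \<Sum>t\<in>T. max 0 (v x - v (x \<otimes> t))) + m * card (out_pairs T X)"
      using IH e1 e2 m(1) iso[OF psubset.hyps psubset.prems(1)]
      by (intro add_mono mult_left_mono) auto
    also have "\<dots> = (\<Sum>x\<in>X. \<Sum>t\<in>T. max 0 (v x - v (x \<otimes> t)) + (if x \<otimes> t \<notin> X then m else 0))"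
      by (simp only: e3[symmetric] sum.distrib)
    also have "\<dots> = (\<Sum>x\<in>X. \<Sum>t\<in>T. max 0 (u x - u (x \<otimes> t)))"
      using m psubset.prems(2,3) by (intro sum.cong refl) (auto simp: v_def max_def)
    finally show ?thesis .
  qed simp
qed

text \<open>
  Apply the coarea inequality to the square of \<open>f\<close> and split each difference of squares \<open>a * b\<close> by
  \<open>2 * a * b \<le> a\<^sup>2 / l + l * b\<^sup>2\<close>, with \<open>a\<close> the difference and \<open>b\<close> the sum of the two values. The choice
  \<open>l = h / (4 * card T)\<close> makes the \<open>l * b\<^sup>2\<close> terms contribute at most half of the left-hand side.
\<close>

lemma cheeger_inequality:
  fixes h :: real
  assumes T: "finite T" "T \<subseteq> carrier G" "T \<noteq> {}"
    and h: "h > 0"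
    and iso: "\<And>F. finite F \<Longrightarrow> F \<subseteq> carrier G \<Longrightarrow> h * card F \<le> card (out_pairs T F)"
    and X: "finite X" "X \<subseteq> carrier G"
    and f: "\<And>x. 0 \<le> f x" "\<And>x. x \<notin> X \<Longrightarrow> f x = 0"
  shows "(\<Sum>x\<in>X. \<Sum>t\<in>T. f x * f (x \<otimes> t)) \<le> (card T - h\<^sup>2 / (8 * card T)) * (\<Sum>x\<in>X. (f x)\<^sup>2)"
proof -
  define D where "D = real (card T)"
  define N where "N = (\<Sum>x\<in>X. (f x)\<^sup>2)"
  define Q where "Q = (\<Sum>x\<in>X. \<Sum>t\<in>T. f x * f (x \<otimes> t))"
  define N' where "N' = (\<Sum>x\<in>X. \<Sum>t\<in>T. (f (x \<otimes> t))\<^sup>2)"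
  have D: "D > 0" using T by (simp add: D_def card_gt_0_iff)
  have N1: "(\<Sum>x\<in>X. \<Sum>t\<in>T. (f x)\<^sup>2) = D * N" by (simp add: D_def N_def sum_distrib_left)
  have N'le: "N' \<le> D * N"
  proof -
    have "(\<Sum>x\<in>X. (f (x \<otimes> t))\<^sup>2) \<le> N" if t: "t \<in> T" for t
    proof -
      have inj: "inj_on (\<lambda>x. x \<otimes> t) X" using X t T by (auto simp: inj_on_def subset_iff)
      have "(\<Sum>x\<in>X. (f (x \<otimes> t))\<^sup>2) = (\<Sum>y\<in>(\<lambda>x. x \<otimes> t) ` X. (f y)\<^sup>2)"
        using inj by (simp add: sum.reindex)
      also have "\<dots> = (\<Sum>y\<in>(\<lambda>x. x \<otimes> t) ` X \<inter> X. (f y)\<^sup>2)"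
        using X f by (intro sum.mono_neutral_right) auto
      also have "\<dots> \<le> N" unfolding N_def using X by (intro sum_mono2) auto
      finally show ?thesis .
    qed
    then have "(\<Sum>t\<in>T. \<Sum>x\<in>X. (f (x \<otimes> t))\<^sup>2) \<le> (\<Sum>t\<in>T. N)" by (intro sum_mono)
    then show ?thesis unfolding N'_def by (subst sum.swap) (simp add: D_def)
  qed
  define l where "l = h / (4 * D)"
  have l: "l > 0" using h D by (simp add: l_def)
  have pt: "max 0 (a\<^sup>2 - b\<^sup>2) \<le> 1 / (2 * l) * (a - b)\<^sup>2 + l / 2 * (a + b)\<^sup>2" for a b :: real
  proof -
    have "0 \<le> (1 / (2 * l)) * ((a - b) - l * (a + b))\<^sup>2" using l by simp
    also have "\<dots> = 1 / (2 * l) * (a - b)\<^sup>2 + l / 2 * (a + b)\<^sup>2 - (a\<^sup>2 - b\<^sup>2)"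
      using l by (simp add: field_simps power2_eq_square)
    finally show ?thesis using l by (simp add: max_def)
  qed
  have "h * N \<le> (\<Sum>x\<in>X. \<Sum>t\<in>T. max 0 ((f x)\<^sup>2 - (f (x \<otimes> t))\<^sup>2))"
    unfolding N_def using f by (intro coarea_inequality[OF T(1) iso X]) auto
  also have "\<dots> \<le> (\<Sum>x\<in>X. \<Sum>t\<in>T. 1 / (2 * l) * (f x - f (x \<otimes> t))\<^sup>2 + l / 2 * (f x + f (x \<otimes> t))\<^sup>2)"
    by (intro sum_mono pt)
  also have "\<dots> = 1 / (2 * l) * (D * N + N' - 2 * Q) + l / 2 * (D * N + N' + 2 * Q)"
    unfolding N1[symmetric] N'_def Q_def
    by (simp add: sum.distrib sum_distrib_left sum_subtractf power2_eq_square algebra_simps)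
  also have "\<dots> \<le> 1 / (2 * l) * (2 * D * N - 2 * Q) + l / 2 * (4 * D * N)"
  proof -
    have "2 * Q \<le> D * N + N'"
    proof -
      have "0 \<le> (\<Sum>x\<in>X. \<Sum>t\<in>T. (f x - f (x \<otimes> t))\<^sup>2)" by (intro sum_nonneg) auto
      also have "\<dots> = D * N + N' - 2 * Q"
        unfolding N1[symmetric] N'_def Q_def
        by (simp add: sum.distrib sum_distrib_left sum_subtractf power2_eq_square algebra_simps)
      finally show ?thesis by simp
    qed
    then show ?thesis using N'le l by (intro add_mono mult_left_mono) auto
  qed
  also have "\<dots> = (D * N - Q) / l + 2 * l * D * N" using l by (simp add: field_simps)
  also have "\<dots> = 4 * D / h * (D * N - Q) + h / 2 * N" using h D by (simp add: l_def field_simps)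
  finally have "h / 2 * N \<le> 4 * D / h * (D * N - Q)" by simp
  then have "h\<^sup>2 / (8 * D) * N \<le> D * N - Q"
    using h D by (simp add: field_simps power2_eq_square)
  then show ?thesis by (simp add: Q_def N_def D_def algebra_simps)
qed

text \<open>
  For \<open>w \<ge> 0\<close> this says that convolution with \<open>w\<close> on \<open>l\<^sup>2\<close> of the group has operator norm at most \<open>c\<close>.
  Non-negative functions suffice to detect that norm, and finite windows \<open>X\<close> and \<open>Y\<close> keep all sums finite.
\<close>

definition conv_bound :: "('a \<Rightarrow> real) \<Rightarrow> real \<Rightarrow> bool" where
  "conv_bound w c \<longleftrightarrow> (\<forall>X Y f g. finite X \<longrightarrow> finite Y \<longrightarrow> X \<subseteq> carrier G \<longrightarrow> Y \<subseteq> carrier G \<longrightarrow>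
     (\<forall>x. 0 \<le> f x) \<longrightarrow> (\<forall>x. 0 \<le> g x) \<longrightarrow>
     (\<Sum>x\<in>X. \<Sum>y\<in>Y. w (inv x \<otimes> y) * f x * g y) \<le> c * L2_set f X * L2_set g Y)"

lemma conv_boundD:
  assumes "conv_bound w c" "finite X" "finite Y" "X \<subseteq> carrier G" "Y \<subseteq> carrier G"
    "\<And>x. 0 \<le> f x" "\<And>x. 0 \<le> g x"
  shows "(\<Sum>x\<in>X. \<Sum>y\<in>Y. w (inv x \<otimes> y) * f x * g y) \<le> c * L2_set f X * L2_set g Y"
  using assms unfolding conv_bound_def by blast

lemma sum_indicator_translate:
  fixes g :: "'a \<Rightarrow> real"
  assumes T: "finite T" "T \<subseteq> carrier G" and Y: "finite Y" "Y \<subseteq> carrier G" and x: "x \<in> carrier G"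
    and g: "\<And>y. y \<notin> Y \<Longrightarrow> g y = 0"
  shows "(\<Sum>y\<in>Y. indicator T (inv x \<otimes> y) * g y) = (\<Sum>t\<in>T. g (x \<otimes> t))"
proof -
  have inj: "inj_on (\<lambda>t. x \<otimes> t) T" using T x by (auto simp: inj_on_def subset_iff)
  have "(\<Sum>y\<in>Y. indicator T (inv x \<otimes> y) * g y) = (\<Sum>y\<in>Y. if inv x \<otimes> y \<in> T then g y else 0)"
    by (intro sum.cong) (auto simp: indicator_def)
  also have "\<dots> = (\<Sum>y\<in>{y\<in>Y. inv x \<otimes> y \<in> T}. g y)"
    by (rule sum.inter_filter[symmetric, OF Y(1)])
  also have "\<dots> = (\<Sum>y\<in>(\<lambda>t. x \<otimes> t) ` T. g y)"
  proof (rule sum.mono_neutral_left)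
    show "finite ((\<lambda>t. x \<otimes> t) ` T)" using T by simp
    show "{y \<in> Y. inv x \<otimes> y \<in> T} \<subseteq> (\<lambda>t. x \<otimes> t) ` T"
    proof
      fix y assume y: "y \<in> {y \<in> Y. inv x \<otimes> y \<in> T}"
      then have "y = x \<otimes> (inv x \<otimes> y)" using x Y by (auto simp: m_assoc[symmetric])
      with y show "y \<in> (\<lambda>t. x \<otimes> t) ` T" by blast
    qed
    show "\<forall>y\<in>(\<lambda>t. x \<otimes> t) ` T - {y \<in> Y. inv x \<otimes> y \<in> T}. g y = 0"
    proof
      fix y assume y: "y \<in> (\<lambda>t. x \<otimes> t) ` T - {y \<in> Y. inv x \<otimes> y \<in> T}"
      then obtain t where t: "t \<in> T" "y = x \<otimes> t" by auto
      then have "inv x \<otimes> y = t" using x T by (auto simp: m_assoc[symmetric])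
      with y t have "y \<notin> Y" by auto
      then show "g y = 0" by (rule g)
    qed
  qed
  also have "\<dots> = (\<Sum>t\<in>T. g (x \<otimes> t))" using inj by (simp add: sum.reindex)
  finally show ?thesis .
qed

text \<open>
  Kesten's criterion in quantitative form: Cheeger's inequality bounds the diagonal of the quadratic
  form, and polarisation applies because \<open>T\<close> is symmetric. The two windows are merged into one by
  extending both functions by zero.
\<close>

lemma conv_bound_if_isoperimetric:
  fixes h :: real
  assumes T: "finite T" "T \<subseteq> carrier G" "T \<noteq> {}" and sym: "\<And>t. t \<in> T \<Longrightarrow> inv t \<in> T"
    and h: "h > 0"
    and iso: "\<And>F. finite F \<Longrightarrow> F \<subseteq> carrier G \<Longrightarrow> h * card F \<le> card (out_pairs T F)"
  shows "conv_bound (indicator T) (card T - h\<^sup>2 / (8 * card T))"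
  unfolding conv_bound_def
proof (intro allI impI)
  fix X Y and f g :: "'a \<Rightarrow> real"
  assume X: "finite X" "X \<subseteq> carrier G" and Y: "finite Y" "Y \<subseteq> carrier G"
    and f: "\<forall>x. 0 \<le> f x" and g: "\<forall>x. 0 \<le> g x"
  let ?r = "card T - h\<^sup>2 / (8 * card T)"
  let ?K = "\<lambda>x y. indicator T (inv x \<otimes> y) :: real"
  define Z where "Z = X \<union> Y"
  have Z: "finite Z" "Z \<subseteq> carrier G" using X Y by (auto simp: Z_def)
  define f' where "f' x = (if x \<in> X then f x else 0)" for x
  define g' where "g' x = (if x \<in> Y then g x else 0)" for x
  have Ksym: "?K x y = ?K y x" if "x \<in> Z" "y \<in> Z" for x y
  proof -
    have xy: "x \<in> carrier G" "y \<in> carrier G" using that Z by auto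
    have e: "inv (inv x \<otimes> y) = inv y \<otimes> x" "inv (inv y \<otimes> x) = inv x \<otimes> y"
      using xy by (simp_all add: inv_mult_group)
    have "inv x \<otimes> y \<in> T \<longleftrightarrow> inv y \<otimes> x \<in> T" using sym[of "inv x \<otimes> y"] sym[of "inv y \<otimes> x"] e by auto
    then show ?thesis by (simp add: indicator_def)
  qed
  have "(\<Sum>x\<in>Z. \<Sum>y\<in>Z. ?K x y * f' x * g' y) \<le> ?r * L2_set f' Z * L2_set g' Z"
  proof (rule symmetric_form_bound[OF Z(1) Ksym])
    fix u :: "'a \<Rightarrow> real" assume u: "\<And>x. 0 \<le> u x"
    define u' where "u' x = (if x \<in> Z then u x else 0)" for x
    have "(\<Sum>x\<in>Z. \<Sum>y\<in>Z. ?K x y * u x * u y) = (\<Sum>x\<in>Z. u' x * (\<Sum>y\<in>Z. ?K x y * u' y))"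
      by (simp add: u'_def sum_distrib_left mult_ac)
    also have "\<dots> = (\<Sum>x\<in>Z. u' x * (\<Sum>t\<in>T. u' (x \<otimes> t)))"
      using Z T by (intro sum.cong refl arg_cong2[of _ _ _ _ "(*)"] sum_indicator_translate) (auto simp: u'_def)
    also have "\<dots> = (\<Sum>x\<in>Z. \<Sum>t\<in>T. u' x * u' (x \<otimes> t))" by (simp add: sum_distrib_left)
    also have "\<dots> \<le> ?r * (\<Sum>x\<in>Z. (u' x)\<^sup>2)"
      using u by (intro cheeger_inequality[OF T h iso Z]) (auto simp: u'_def)
    finally show "(\<Sum>x\<in>Z. \<Sum>y\<in>Z. ?K x y * u x * u y) \<le> ?r * (\<Sum>x\<in>Z. (u x)\<^sup>2)"
      by (simp add: u'_def)
  qed (use f g in \<open>auto simp: f'_def g'_def\<close>)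
  moreover have "(\<Sum>x\<in>Z. \<Sum>y\<in>Z. ?K x y * f' x * g' y) = (\<Sum>x\<in>X. \<Sum>y\<in>Y. ?K x y * f x * g y)"
  proof -
    have "(\<Sum>x\<in>Z. \<Sum>y\<in>Z. ?K x y * f' x * g' y) = (\<Sum>x\<in>X. \<Sum>y\<in>Z. ?K x y * f' x * g' y)"
      using Z by (intro sum.mono_neutral_right) (auto simp: Z_def f'_def)
    also have "\<dots> = (\<Sum>x\<in>X. \<Sum>y\<in>Y. ?K x y * f' x * g' y)"
      using Z by (intro sum.cong refl sum.mono_neutral_right) (auto simp: Z_def g'_def)
    finally show ?thesis by (simp add: f'_def g'_def)
  qed
  moreover have "L2_set f' Z = L2_set f X"
  proof -
    have "(\<Sum>x\<in>Z. (f' x)\<^sup>2) = (\<Sum>x\<in>X. (f' x)\<^sup>2)"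
      using Z by (intro sum.mono_neutral_right) (auto simp: Z_def f'_def)
    then show ?thesis by (simp add: L2_set_def f'_def)
  qed
  moreover have "L2_set g' Z = L2_set g Y"
  proof -
    have "(\<Sum>x\<in>Z. (g' x)\<^sup>2) = (\<Sum>x\<in>Y. (g' x)\<^sup>2)"
      using Z by (intro sum.mono_neutral_right) (auto simp: Z_def g'_def)
    then show ?thesis by (simp add: L2_set_def g'_def)
  qed
  ultimately show "(\<Sum>x\<in>X. \<Sum>y\<in>Y. ?K x y * f x * g y) \<le> ?r * L2_set f X * L2_set g Y" by simp
qed

end

section \<open>Convolution norms and word counts\<close>

context group
begin

lemma conv_bound_mono:
  assumes "conv_bound w c" and le: "\<And>z. z \<in> carrier G \<Longrightarrow> w' z \<le> w z"
  shows "conv_bound w' c"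
  unfolding conv_bound_def
proof (intro allI impI)
  fix X Y and f g :: "'a \<Rightarrow> real"
  assume A: "finite X" "finite Y" "X \<subseteq> carrier G" "Y \<subseteq> carrier G" "\<forall>x. 0 \<le> f x" "\<forall>x. 0 \<le> g x"
  have "(\<Sum>x\<in>X. \<Sum>y\<in>Y. w' (inv x \<otimes> y) * f x * g y) \<le> (\<Sum>x\<in>X. \<Sum>y\<in>Y. w (inv x \<otimes> y) * f x * g y)"
    using A by (intro sum_mono mult_right_mono le) auto
  also have "\<dots> \<le> c * L2_set f X * L2_set g Y" using A by (intro conv_boundD[OF assms(1)]) auto
  finally show "(\<Sum>x\<in>X. \<Sum>y\<in>Y. w' (inv x \<otimes> y) * f x * g y) \<le> c * L2_set f X * L2_set g Y" .
qed

lemma conv_bound_add: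
  assumes "conv_bound w c" "conv_bound w' c'"
  shows "conv_bound (\<lambda>z. w z + w' z) (c + c')"
  unfolding conv_bound_def
proof (intro allI impI)
  fix X Y and f g :: "'a \<Rightarrow> real"
  assume A: "finite X" "finite Y" "X \<subseteq> carrier G" "Y \<subseteq> carrier G" "\<forall>x. 0 \<le> f x" "\<forall>x. 0 \<le> g x"
  have "(\<Sum>x\<in>X. \<Sum>y\<in>Y. w (inv x \<otimes> y) * f x * g y) + (\<Sum>x\<in>X. \<Sum>y\<in>Y. w' (inv x \<otimes> y) * f x * g y)
      \<le> c * L2_set f X * L2_set g Y + c' * L2_set f X * L2_set g Y"
    using A by (intro add_mono conv_boundD assms) auto
  then show "(\<Sum>x\<in>X. \<Sum>y\<in>Y. (w (inv x \<otimes> y) + w' (inv x \<otimes> y)) * f x * g y)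
      \<le> (c + c') * L2_set f X * L2_set g Y"
    by (simp add: sum.distrib algebra_simps)
qed

lemma conv_bound_scale:
  assumes "conv_bound w c" "0 \<le> a"
  shows "conv_bound (\<lambda>z. a * w z) (a * c)"
  unfolding conv_bound_def
proof (intro allI impI)
  fix X Y and f g :: "'a \<Rightarrow> real"
  assume A: "finite X" "finite Y" "X \<subseteq> carrier G" "Y \<subseteq> carrier G" "\<forall>x. 0 \<le> f x" "\<forall>x. 0 \<le> g x"
  have "a * (\<Sum>x\<in>X. \<Sum>y\<in>Y. w (inv x \<otimes> y) * f x * g y) \<le> a * (c * L2_set f X * L2_set g Y)"
    using A assms(2) by (intro mult_left_mono conv_boundD[OF assms(1)]) auto
  then show "(\<Sum>x\<in>X. \<Sum>y\<in>Y. a * w (inv x \<otimes> y) * f x * g y) \<le> a * c * L2_set f X * L2_set g Y"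
    by (simp add: sum_distrib_left mult.assoc)
qed

lemma conv_bound_inverse:
  assumes "conv_bound w c"
  shows "conv_bound (\<lambda>z. w (inv z)) c"
  unfolding conv_bound_def
proof (intro allI impI)
  fix X Y and f g :: "'a \<Rightarrow> real"
  assume A: "finite X" "finite Y" "X \<subseteq> carrier G" "Y \<subseteq> carrier G" "\<forall>x. 0 \<le> f x" "\<forall>x. 0 \<le> g x"
  have "(\<Sum>x\<in>X. \<Sum>y\<in>Y. w (inv (inv x \<otimes> y)) * f x * g y) = (\<Sum>y\<in>Y. \<Sum>x\<in>X. w (inv y \<otimes> x) * g y * f x)"
    using A by (subst sum.swap) (auto intro!: sum.cong simp: inv_mult_group subset_iff)
  also have "\<dots> \<le> c * L2_set g Y * L2_set f X"
    using A by (intro conv_boundD[OF assms]) auto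
  finally show "(\<Sum>x\<in>X. \<Sum>y\<in>Y. w (inv (inv x \<otimes> y)) * f x * g y) \<le> c * L2_set f X * L2_set g Y"
    by (simp add: mult_ac)
qed

text \<open>
  The value \<open>w z\<close> is the matrix coefficient of the convolution operator at the unit vectors of \<open>\<one>\<close> and \<open>z\<close>.
\<close>

lemma conv_bound_value:
  assumes "conv_bound w c" "z \<in> carrier G"
  shows "w z \<le> c"
  using conv_boundD[OF assms(1), of "{\<one>}" "{z}" "\<lambda>_. 1" "\<lambda>_. 1"] assms(2)
  by (simp add: L2_set_def)

text \<open>
  Evaluated at the indicator function of \<open>C\<close>, the quadratic form counts the pairs \<open>(x, s)\<close> that stay
  inside \<open>C\<close>, so at most \<open>c * card C\<close> of the \<open>card S * card C\<close> pairs do.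
\<close>

lemma out_pairs_lower_bound:
  fixes c :: real
  assumes S: "finite S" "S \<subseteq> carrier G" and bd: "conv_bound (indicator S) c"
    and C: "finite C" "C \<subseteq> carrier G"
  shows "(card S - c) * card C \<le> card (out_pairs S C)"
proof -
  have "(\<Sum>x\<in>C. \<Sum>t\<in>S. indicator C (x \<otimes> t)) = (\<Sum>x\<in>C. \<Sum>y\<in>C. indicator S (inv x \<otimes> y) * (indicator C y :: real))"
    using S C by (intro sum.cong refl sum_indicator_translate[symmetric]) auto
  also have "\<dots> = (\<Sum>x\<in>C. \<Sum>y\<in>C. indicator S (inv x \<otimes> y) * 1 * 1)"
    by (intro sum.cong) auto
  also have "\<dots> \<le> c * L2_set (\<lambda>_. 1) C * L2_set (\<lambda>_. 1) C"
    using C by (intro conv_boundD[OF bd]) auto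
  also have "\<dots> = c * card C" by (simp add: L2_set_def)
  finally have le: "(\<Sum>x\<in>C. \<Sum>t\<in>S. indicator C (x \<otimes> t)) \<le> c * card C" .
  have "real (card (out_pairs S C)) = (\<Sum>z\<in>{z \<in> C \<times> S. fst z \<otimes> snd z \<notin> C}. 1)"
    by (simp add: out_pairs_def case_prod_unfold mem_Times_iff conj_assoc)
  also have "\<dots> = (\<Sum>z\<in>C \<times> S. if fst z \<otimes> snd z \<notin> C then 1 else 0)"
    using C S by (intro sum.inter_filter) auto
  also have "\<dots> = (\<Sum>x\<in>C. \<Sum>t\<in>S. 1 - indicator C (x \<otimes> t) :: real)"
    by (auto simp: sum.cartesian_product intro!: sum.cong)
  also have "\<dots> = real (card S) * real (card C) - (\<Sum>x\<in>C. \<Sum>t\<in>S. indicator C (x \<otimes> t))"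
    by (simp add: sum_subtractf mult.commute)
  finally show ?thesis using le by (simp add: algebra_simps)
qed

definition wprod :: "'a list \<Rightarrow> 'a" where
  "wprod ws = foldr (\<otimes>) ws \<one>"

lemma wprod_simps [simp]: "wprod [] = \<one>" "wprod (s # ws) = s \<otimes> wprod ws"
  by (simp_all add: wprod_def)

lemma wprod_closed [simp]: "set ws \<subseteq> carrier G \<Longrightarrow> wprod ws \<in> carrier G"
  by (induction ws) auto

definition words :: "'a set \<Rightarrow> nat \<Rightarrow> 'a \<Rightarrow> 'a list set" where
  "words T n z = {ws. set ws \<subseteq> T \<and> length ws = n \<and> wprod ws = z}"

lemma finite_words: "finite T \<Longrightarrow> finite (words T n z)"
  by (rule finite_subset[OF _ finite_lists_length_eq[of T n]]) (auto simp: words_def)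

lemma words_0: "words T 0 z = (if z = \<one> then {[]} else {})"
  by (auto simp: words_def)

lemma card_words_Suc:
  assumes T: "finite T" "T \<subseteq> carrier G" and z: "z \<in> carrier G"
  shows "card (words T (Suc n) z) = (\<Sum>t\<in>T. card (words T n (inv t \<otimes> z)))"
proof -
  have "words T (Suc n) z = (\<Union>t\<in>T. (#) t ` words T n (inv t \<otimes> z))"
  proof
    show "words T (Suc n) z \<subseteq> (\<Union>t\<in>T. (#) t ` words T n (inv t \<otimes> z))"
    proof
      fix ws assume ws: "ws \<in> words T (Suc n) z"
      then obtain t us where us: "ws = t # us" by (auto simp: words_def length_Suc_conv)
      then have "t \<in> T" "set us \<subseteq> T" "length us = n" "t \<otimes> wprod us = z" using ws by (auto simp: words_def)
      moreover from this have "wprod us = inv t \<otimes> z"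
        using T by (auto simp: m_assoc[symmetric] subset_iff)
      ultimately show "ws \<in> (\<Union>t\<in>T. (#) t ` words T n (inv t \<otimes> z))" using us by (auto simp: words_def)
    qed
    show "(\<Union>t\<in>T. (#) t ` words T n (inv t \<otimes> z)) \<subseteq> words T (Suc n) z"
      using T z by (auto simp: words_def m_assoc[symmetric] subset_iff)
  qed
  then have "card (words T (Suc n) z) = card (\<Union>t\<in>T. (#) t ` words T n (inv t \<otimes> z))" by simp
  also have "\<dots> = (\<Sum>t\<in>T. card ((#) t ` words T n (inv t \<otimes> z)))"
    using T by (intro card_UN_disjoint) (auto simp: finite_words)
  also have "\<dots> = (\<Sum>t\<in>T. card (words T n (inv t \<otimes> z)))"
    by (intro sum.cong refl card_image) auto
  finally show ?thesis .
qed

text \<open>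
  The number of words of length \<open>k\<close> is the \<open>k\<close>-fold convolution power of the indicator function of
  \<open>T\<close>, and operator norms are submultiplicative.
\<close>

lemma conv_bound_words:
  assumes T: "finite T" "T \<subseteq> carrier G" and r: "0 \<le> r" and bd: "conv_bound (indicator T) r"
  shows "conv_bound (\<lambda>z. card (words T k z)) (r ^ k)"
proof (induction k)
  case 0
  show ?case unfolding conv_bound_def
  proof (intro allI impI)
    fix X Y and f g :: "'a \<Rightarrow> real"
    assume A: "finite X" "finite Y" "X \<subseteq> carrier G" "Y \<subseteq> carrier G" "\<forall>x. 0 \<le> f x" "\<forall>x. 0 \<le> g x"
    have "(\<Sum>x\<in>X. \<Sum>y\<in>Y. card (words T 0 (inv x \<otimes> y)) * f x * g y)
        = (\<Sum>x\<in>X. \<Sum>y\<in>Y. if x = y then f x * g y else 0)"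
    proof (intro sum.cong refl)
      fix x y assume "x \<in> X" "y \<in> Y"
      then have xy: "x \<in> carrier G" "y \<in> carrier G" using A by auto
      have "inv x \<otimes> y = \<one> \<longleftrightarrow> x = y"
      proof
        assume "inv x \<otimes> y = \<one>"
        then have "x \<otimes> (inv x \<otimes> y) = x" using xy by simp
        then show "x = y" using xy by (simp add: m_assoc[symmetric])
      qed (use xy in simp)
      then show "real (card (words T 0 (inv x \<otimes> y))) * f x * g y = (if x = y then f x * g y else 0)"
        by (simp add: words_0)
    qed
    also have "\<dots> = (\<Sum>x\<in>X. if x \<in> Y then f x * g x else 0)"
      using A by (simp add: sum.delta')
    also have "\<dots> = (\<Sum>x\<in>X \<inter> Y. \<bar>f x\<bar> * \<bar>g x\<bar>)"
      using A by (simp add: sum.inter_restrict)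
    also have "\<dots> \<le> L2_set f (X \<inter> Y) * L2_set g (X \<inter> Y)" by (rule L2_set_mult_ineq)
    also have "\<dots> \<le> L2_set f X * L2_set g Y"
      using A by (intro mult_mono) (auto simp: L2_set_def intro!: sum_mono2 sum_nonneg)
    finally show "(\<Sum>x\<in>X. \<Sum>y\<in>Y. card (words T 0 (inv x \<otimes> y)) * f x * g y) \<le> r ^ 0 * L2_set f X * L2_set g Y"
      by simp
  qed
next
  case (Suc k)
  show ?case unfolding conv_bound_def
  proof (intro allI impI)
    fix X Y and f g :: "'a \<Rightarrow> real"
    assume A: "finite X" "finite Y" "X \<subseteq> carrier G" "Y \<subseteq> carrier G" "\<forall>x. 0 \<le> f x" "\<forall>x. 0 \<le> g x"
    define Z where "Z = (\<lambda>(x, t). x \<otimes> t) ` (X \<times> T)"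
    have Z: "finite Z" "Z \<subseteq> carrier G" using A T by (auto simp: Z_def)
    let ?W = "\<lambda>k z. real (card (words T k z))"
    \<comment> \<open>The first letter is split off: \<open>h\<close> is the convolution of \<open>f\<close> with the indicator of \<open>T\<close>, and \<open>Z\<close> contains its support.\<close>
    define h where "h z = (\<Sum>x\<in>X. indicator T (inv x \<otimes> z) * f x)" for z
    have h: "0 \<le> h z" for z unfolding h_def using A by (intro sum_nonneg) auto
    define H where "H z = (if z \<in> Z then \<Sum>y\<in>Y. ?W k (inv z \<otimes> y) * g y else 0)" for z
    have "(\<Sum>x\<in>X. \<Sum>y\<in>Y. ?W (Suc k) (inv x \<otimes> y) * f x * g y) = (\<Sum>x\<in>X. f x * (\<Sum>t\<in>T. H (x \<otimes> t)))"
    proof (intro sum.cong refl)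
      fix x assume x: "x \<in> X"
      then have xc: "x \<in> carrier G" using A by auto
      have "(\<Sum>y\<in>Y. ?W (Suc k) (inv x \<otimes> y) * f x * g y) = (\<Sum>y\<in>Y. \<Sum>t\<in>T. ?W k (inv t \<otimes> (inv x \<otimes> y)) * f x * g y)"
        using A xc T by (intro sum.cong refl) (auto simp: card_words_Suc sum_distrib_right subset_iff)
      also have "\<dots> = (\<Sum>t\<in>T. \<Sum>y\<in>Y. ?W k (inv t \<otimes> (inv x \<otimes> y)) * f x * g y)" by (rule sum.swap)
      also have "\<dots> = (\<Sum>t\<in>T. f x * H (x \<otimes> t))"
      proof (intro sum.cong refl)
        fix t assume t: "t \<in> T"
        then have tc: "t \<in> carrier G" using T by auto
        have xt: "x \<otimes> t \<in> Z" using x t by (force simp: Z_def)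
        have "inv t \<otimes> (inv x \<otimes> y) = inv (x \<otimes> t) \<otimes> y" if "y \<in> Y" for y
          using that A xc tc by (auto simp: inv_mult_group m_assoc subset_iff)
        then show "(\<Sum>y\<in>Y. ?W k (inv t \<otimes> (inv x \<otimes> y)) * f x * g y) = f x * H (x \<otimes> t)"
          using xt by (auto simp: H_def sum_distrib_left mult_ac intro!: sum.cong)
      qed
      finally show "(\<Sum>y\<in>Y. ?W (Suc k) (inv x \<otimes> y) * f x * g y) = f x * (\<Sum>t\<in>T. H (x \<otimes> t))"
        by (simp add: sum_distrib_left)
    qed
    also have "\<dots> = (\<Sum>x\<in>X. f x * (\<Sum>z\<in>Z. indicator T (inv x \<otimes> z) * H z))"
      using A by (intro sum.cong refl arg_cong2[of _ _ _ _ "(*)"] sum_indicator_translate[symmetric] T Z)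
        (auto simp: H_def)
    also have "\<dots> = (\<Sum>x\<in>X. \<Sum>z\<in>Z. indicator T (inv x \<otimes> z) * f x * H z)"
      by (simp add: sum_distrib_left mult_ac)
    also have "\<dots> = (\<Sum>z\<in>Z. h z * H z)"
      by (subst sum.swap) (simp add: h_def sum_distrib_right)
    also have "\<dots> = (\<Sum>z\<in>Z. \<Sum>y\<in>Y. ?W k (inv z \<otimes> y) * h z * g y)"
      by (auto intro!: sum.cong simp: H_def sum_distrib_left)
    also have "\<dots> \<le> r ^ k * L2_set h Z * L2_set g Y"
      using A Z h by (intro conv_boundD[OF Suc.IH]) auto
    also have "\<dots> \<le> r ^ k * (r * L2_set f X) * L2_set g Y"
    proof (intro mult_right_mono mult_left_mono)
      \<comment> \<open>Testing the convolution against itself bounds its norm.\<close>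
      have "(L2_set h Z)\<^sup>2 = (\<Sum>z\<in>Z. h z * h z)"
        by (simp add: L2_set_def sum_nonneg power2_eq_square)
      also have "\<dots> = (\<Sum>x\<in>X. \<Sum>z\<in>Z. indicator T (inv x \<otimes> z) * f x * h z)"
        by (subst sum.swap) (simp add: h_def sum_distrib_right)
      also have "\<dots> \<le> r * L2_set f X * L2_set h Z"
        using A Z h by (intro conv_boundD[OF bd]) auto
      finally have sq: "L2_set h Z * L2_set h Z \<le> r * L2_set f X * L2_set h Z" by (simp add: power2_eq_square)
      show "L2_set h Z \<le> r * L2_set f X"
      proof (cases "L2_set h Z = 0")
        case True then show ?thesis using r by (simp add: L2_set_nonneg)
      next
        case False
        then have "L2_set h Z > 0" using L2_set_nonneg[of h Z] by linarith
        then show ?thesis using sq by (simp add: mult_le_cancel_right)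
      qed
    qed (use r in \<open>auto simp: L2_set_nonneg\<close>)
    finally show "(\<Sum>x\<in>X. \<Sum>y\<in>Y. ?W (Suc k) (inv x \<otimes> y) * f x * g y) \<le> r ^ Suc k * L2_set f X * L2_set g Y"
      by (simp add: mult_ac)
  qed
qed

lemma card_words_le:
  fixes r :: real
  assumes "finite T" "T \<subseteq> carrier G" "0 \<le> r" "conv_bound (indicator T) r" "z \<in> carrier G"
  shows "card (words T k z) \<le> r ^ k"
  using conv_bound_value[OF conv_bound_words[OF assms(1-4)] assms(5)] .

text \<open>
  On the set where the word count \<open>W\<close> lies between \<open>2 ^ j\<close> and \<open>2 ^ (j + 1)\<close>, the indicator function is
  at most \<open>W / 2 ^ j\<close>, hence has norm at most \<open>r ^ k / 2 ^ j\<close>; and the size of the set is at least its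
  mass divided by \<open>2 ^ (j + 1)\<close>. Since \<open>W \<le> card T ^ k \<le> 2 ^ (card T * k)\<close>, there are at most
  \<open>card T * k + 1\<close> levels, and the one of largest mass proves the claim.
\<close>

lemma dense_level_set:
  fixes k :: nat and r :: real
  assumes T: "finite T" "T \<subseteq> carrier G" "T \<noteq> {}" and r: "0 \<le> r" and bd: "conv_bound (indicator T) r"
  obtains A c where "finite A" "A \<subseteq> carrier G" "A \<noteq> {}" "conv_bound (indicator A) c"
    "card A \<le> card T ^ k" "c \<le> 2 * (card T * k + 1) * (r / card T) ^ k * card A"
proof -
  define D where "D = card T"
  have D: "D > 0" using T by (simp add: D_def card_gt_0_iff)
  define L where "L = {ws. set ws \<subseteq> T \<and> length ws = k}"
  have L: "finite L" "card L = D ^ k"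
    unfolding L_def D_def using T by (auto simp: finite_lists_length_eq card_lists_length_eq)
  define V where "V = wprod ` L"
  have V: "finite V" "V \<subseteq> carrier G" "card V \<le> D ^ k"
    using L card_image_le[OF L(1), of wprod] T by (auto simp: V_def L_def)
  define W where "W z = card (words T k z)" for z
  have W: "W z = card {ws \<in> L. wprod ws = z}" for z
    unfolding W_def words_def L_def by (rule arg_cong[of _ _ card]) auto
  have total: "(\<Sum>z\<in>V. W z) = D ^ k"
    using sum.group[of L V wprod "\<lambda>_. 1::nat"] L V by (simp add: W V_def)
  have W1: "1 \<le> W z" if "z \<in> V" for z
    using that L unfolding W V_def by (auto simp: Suc_le_eq card_gt_0_iff)
  have W2: "W z \<le> D ^ k" for z
    unfolding W L(2)[symmetric] using L by (intro card_mono) auto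
  have "\<forall>z\<in>V. \<exists>j. 2 ^ j \<le> W z \<and> W z < 2 ^ (j + 1)"
    using ex_power_ivl1[of 2] W1 by auto
  then obtain lev where lev: "\<And>z. z \<in> V \<Longrightarrow> 2 ^ lev z \<le> W z \<and> W z < 2 ^ (lev z + 1)" by metis
  have levle: "lev z \<le> D * k" if z: "z \<in> V" for z
  proof -
    have "(2::nat) ^ lev z \<le> D ^ k" using lev[OF z] W2[of z] by linarith
    also have "\<dots> \<le> (2 ^ D) ^ k" by (intro power_mono less_imp_le[OF less_exp]) auto
    finally have "(2::nat) ^ lev z \<le> 2 ^ (D * k)" by (simp add: power_mult)
    then show ?thesis by simp
  qed
  have groups: "(\<Sum>j\<le>D*k. \<Sum>z\<in>{z\<in>V. lev z = j}. W z) = D ^ k"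
    using sum.group[of V "{..D*k}" lev W] V levle total by auto
  have "\<exists>j. D ^ k \<le> (D * k + 1) * (\<Sum>z\<in>{z\<in>V. lev z = j}. W z)"
  proof (rule ccontr)
    assume "\<not> ?thesis"
    then have *: "(D * k + 1) * (\<Sum>z\<in>{z\<in>V. lev z = j}. W z) < D ^ k" for j by (auto simp: not_le)
    have "(D * k + 1) * D ^ k = (\<Sum>j\<le>D*k. (D * k + 1) * (\<Sum>z\<in>{z\<in>V. lev z = j}. W z))"
      by (simp only: groups[symmetric] sum_distrib_left)
    also have "\<dots> < (\<Sum>j\<le>D*k. D ^ k)" using * by (intro sum_strict_mono) auto
    finally show False by simp
  qed
  then obtain j where j: "D ^ k \<le> (D * k + 1) * (\<Sum>z\<in>{z\<in>V. lev z = j}. W z)" by blast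
  define A where "A = {z\<in>V. lev z = j}"
  have A: "finite A" "A \<subseteq> carrier G" using V by (auto simp: A_def)
  have Ane: "A \<noteq> {}"
  proof
    assume "A = {}"
    then have "(\<Sum>z\<in>{z\<in>V. lev z = j}. W z) = 0" unfolding A_def by (simp only: sum.empty)
    then have "D ^ k \<le> 0" using j by simp
    then show False using D by simp
  qed
  have "conv_bound (\<lambda>z. (1 / 2 ^ j) * real (card (words T k z))) ((1 / 2 ^ j) * r ^ k)"
    by (intro conv_bound_scale conv_bound_words T r bd) simp
  then have bdA: "conv_bound (indicator A) ((1 / 2 ^ j) * r ^ k)"
  proof (rule conv_bound_mono)
    fix z assume "z \<in> carrier G"
    show "indicator A z \<le> (1 / 2 ^ j) * real (card (words T k z))"
    proof (cases "z \<in> A")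
      case True
      then have "2 ^ j \<le> card (words T k z)" using lev[of z] by (auto simp: A_def W_def)
      then have "(2::real) ^ j \<le> real (card (words T k z))" by (metis of_nat_le_iff of_nat_numeral of_nat_power)
      then show ?thesis using True by simp
    qed simp
  qed
  have "(\<Sum>z\<in>A. W z) \<le> (\<Sum>z\<in>A. 2 ^ (j + 1))"
    using lev by (intro sum_mono less_imp_le) (auto simp: A_def)
  then have "(D * k + 1) * (\<Sum>z\<in>A. W z) \<le> (D * k + 1) * (2 ^ (j + 1) * card A)"
    by (intro mult_left_mono) (auto simp: mult.commute)
  with j have "D ^ k \<le> (D * k + 1) * (2 ^ (j + 1) * card A)" unfolding A_def by linarith
  then have "real (D ^ k) \<le> real ((D * k + 1) * (2 ^ (j + 1) * card A))" by (rule of_nat_mono)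
  then have "real D ^ k \<le> 2 * 2 ^ j * (D * k + 1) * card A" by (simp add: mult_ac)
  then have "real D ^ k * r ^ k \<le> (2 * 2 ^ j * (D * k + 1) * card A) * r ^ k"
    using r by (intro mult_right_mono) auto
  then have "(1 / 2 ^ j) * r ^ k \<le> 2 * (D * k + 1) * (r / D) ^ k * card A"
    using D by (simp add: power_divide field_simps)
  moreover have "card A \<le> D ^ k" using V(1,3) card_mono[of V A] by (auto simp: A_def)
  ultimately show ?thesis using that[OF A Ane bdA] by (simp add: D_def)
qed

end

section \<open>A generating set of small norm\<close>

lemma square_times_power_tendsto_0:
  fixes q :: real
  assumes "0 < q" "q < 1"
  shows "(\<lambda>k. (real k + 1)\<^sup>2 * q ^ k) \<longlonglongrightarrow> 0"
  using assms by real_asymp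

context group
begin

lemma conv_bound_indicator_ge_1:
  fixes c :: real
  assumes "conv_bound (indicator A) c" "A \<subseteq> carrier G" "A \<noteq> {}"
  shows "1 \<le> c"
proof -
  obtain a where "a \<in> A" using assms by auto
  then show ?thesis using conv_bound_value[OF assms(1), of a] assms(2) by auto
qed

lemma conv_bound_indicator_inverse_image:
  fixes c :: real
  assumes "conv_bound (indicator A) c" "A \<subseteq> carrier G"
  shows "conv_bound (indicator (m_inv G ` A)) c"
  by (rule conv_bound_mono[OF conv_bound_inverse[OF assms(1)]])
     (use assms(2) in \<open>auto simp: indicator_def\<close>)

lemma conv_bound_indicator_Un:
  fixes c :: real
  assumes "conv_bound (indicator A) c" "conv_bound (indicator B) c'"
  shows "conv_bound (indicator (A \<union> B)) (c + c')"
  by (rule conv_bound_mono[OF conv_bound_add[OF assms]]) (auto simp: indicator_def)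

lemma finite_symmetric_generating_set_alt:
  "finite_symmetric_generating_set G S \<longleftrightarrow>
     finite S \<and> S \<subseteq> carrier G \<and> (\<forall>s\<in>S. inv s \<in> S) \<and> generate G S = carrier G"
proof -
  have "set_inv S = S \<longleftrightarrow> (\<forall>s\<in>S. inv s \<in> S)" if S: "S \<subseteq> carrier G"
  proof
    assume inv: "\<forall>s\<in>S. inv s \<in> S"
    have "s \<in> set_inv S" if "s \<in> S" for s
      using inv that S by (auto simp: SET_INV_def intro!: bexI[of _ "inv s"])
    then show "set_inv S = S" using inv by (auto simp: SET_INV_def)
  qed (auto simp: SET_INV_def)
  then show ?thesis unfolding finite_symmetric_generating_set_def by blast
qed

text \<open>
  Norms cannot be negligible: the indicator function of a nonempty set has norm at least 1. Applied to
  the dense level set \<open>A\<close>, this forces \<open>card A\<close> to be exponentially large in \<open>k\<close>, so adding the fixed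
  set \<open>T\<close>, which makes the set generate, does not spoil the ratio of norm to size. The logarithm costs
  only a factor linear in \<open>k\<close>.
\<close>

lemma sparse_generating_set:
  fixes \<epsilon> :: real
  assumes fg: "finitely_generated G" and na: "\<not> amenable G" and eps: "\<epsilon> > 0"
  obtains S c where "finite_symmetric_generating_set G S" "\<one> \<notin> S" "S \<noteq> {}"
    "conv_bound (indicator S) c" "1 \<le> c" "c * (1 + ln (card S)) \<le> \<epsilon> * card S"
proof -
  obtain S0 where S0: "finite S0" "S0 \<subseteq> carrier G" "generate G S0 = carrier G"
    using fg by (auto simp: finitely_generated_def)
  define T where "T = insert \<one> (S0 \<union> m_inv G ` S0)"
  have T: "finite T" "T \<subseteq> carrier G" "T \<noteq> {}" "\<And>t. t \<in> T \<Longrightarrow> inv t \<in> T" "\<one> \<in> T"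
    using S0 by (auto simp: T_def)
  have genT: "generate G T = carrier G"
  proof
    show "generate G T \<subseteq> carrier G" using generate_incl[OF T(2)] .
    show "carrier G \<subseteq> generate G T"
      unfolding S0(3)[symmetric] by (rule mono_generate) (auto simp: T_def)
  qed
  obtain h :: real where h: "h > 0"
    "\<And>F. finite F \<Longrightarrow> F \<subseteq> carrier G \<Longrightarrow> h * card F \<le> card (out_pairs T F)"
    using isoperimetric_if_not_amenable[OF T(1,2) genT T(4) na] by blast
  define D where "D = card T"
  have D: "D > 0" using T by (simp add: D_def card_gt_0_iff)
  define r where "r = D - h\<^sup>2 / (8 * D)"
  have bdT: "conv_bound (indicator T) r"
    unfolding r_def D_def by (rule conv_bound_if_isoperimetric[OF T(1-4) h])
  have r: "1 \<le> r" "r < D"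
    using conv_bound_indicator_ge_1[OF bdT T(2,3)] h(1) D by (auto simp: r_def)
  define q where "q = r / D"
  have q: "0 < q" "q < 1" using r D by (auto simp: q_def)
  \<comment> \<open>\<open>M\<close> collects every constant of the final estimate, so that only the factor in \<open>k\<close> is left to be made small.\<close>
  define M where "M = (real D + 2) * (4 * (real D + 1) * (real D + 3))"
  have M: "M > 0" unfolding M_def by (intro mult_pos_pos) auto
  have "(\<lambda>k. (real k + 1)\<^sup>2 * q ^ k) \<longlonglongrightarrow> 0" by (rule square_times_power_tendsto_0[OF q])
  then have "eventually (\<lambda>k. (real k + 1)\<^sup>2 * q ^ k < min (\<epsilon> / M) (1 / M)) sequentially"
    using eps M by (intro order_tendstoD(2)[where y = 0]) auto
  then obtain k where k: "(real k + 1)\<^sup>2 * q ^ k < min (\<epsilon> / M) (1 / M)"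
    by (auto simp: eventually_sequentially)
  define d where "d = 2 * (D * k + 1) * q ^ k"
  obtain A a where A: "finite A" "A \<subseteq> carrier G" "A \<noteq> {}" "conv_bound (indicator A) a"
    "card A \<le> D ^ k" "a \<le> d * card A"
    using dense_level_set[OF T(1-3) _ bdT, of k] r unfolding d_def q_def D_def by auto
  have a1: "1 \<le> a" by (rule conv_bound_indicator_ge_1[OF A(4,2,3)])
  have d0: "0 \<le> d" using q by (simp add: d_def)
  have key: "(real D + 2) * d * (2 * ((real D + 3) * (real k + 1))) \<le> M * ((real k + 1)\<^sup>2 * q ^ k)"
  proof -
    have "real D * k + 1 \<le> (real D + 1) * (real k + 1)" by (simp add: algebra_simps)
    then have "d \<le> 2 * ((real D + 1) * (real k + 1)) * q ^ k"
      unfolding d_def using q by (intro mult_right_mono) auto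
    then have "(real D + 2) * d * (2 * ((real D + 3) * (real k + 1)))
        \<le> (real D + 2) * (2 * ((real D + 1) * (real k + 1)) * q ^ k) * (2 * ((real D + 3) * (real k + 1)))"
      by (intro mult_right_mono mult_left_mono) auto
    also have "\<dots> = M * ((real k + 1)\<^sup>2 * q ^ k)" by (simp add: M_def power2_eq_square algebra_simps)
    finally show ?thesis .
  qed
  have small: "(real D + 2) * d * (2 * ((real D + 3) * (real k + 1))) \<le> \<epsilon>"
    "(real D + 2) * d * (2 * ((real D + 3) * (real k + 1))) \<le> 1"
  proof -
    have "M * ((real k + 1)\<^sup>2 * q ^ k) < M * (\<epsilon> / M)" "M * ((real k + 1)\<^sup>2 * q ^ k) < M * (1 / M)"
      using k M by (simp_all only: min_less_iff_conj mult_strict_left_mono)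
    then show "(real D + 2) * d * (2 * ((real D + 3) * (real k + 1))) \<le> \<epsilon>"
      "(real D + 2) * d * (2 * ((real D + 3) * (real k + 1))) \<le> 1"
      using key M by auto
  qed
  have dA: "1 \<le> d * card A" using A(6) a1 by linarith
  \<comment> \<open>Two elements are enough for removing \<open>\<one>\<close> to cost at most half of \<open>A\<close>.\<close>
  have A2: "2 \<le> card A"
  proof -
    have "2 * d \<le> (real D + 2) * d * (2 * ((real D + 3) * (real k + 1)))"
    proof -
      have "1 * d * (2 * 1) \<le> (real D + 2) * d * (2 * ((real D + 3) * (real k + 1)))"
        using d0 by (intro mult_mono) (auto simp: algebra_simps)
      then show ?thesis by (simp add: mult_ac)
    qed
    with small(2) have "d * 2 \<le> d * card A" using dA by linarith
    moreover have "d > 0" using dA d0 by (cases "d = 0") auto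
    ultimately have "2 \<le> real (card A)" by (simp add: mult_le_cancel_left)
    then show ?thesis by simp
  qed
  define S where "S = (T \<union> (A \<union> m_inv G ` A)) - {\<one>}"
  define c where "c = r + (a + a)"
  have Sfin: "finite S" "S \<subseteq> carrier G" using T A by (auto simp: S_def)
  have Ssym: "inv s \<in> S" if "s \<in> S" for s
    using that T A(2) by (auto simp: S_def subset_iff)
  have Sgen: "generate G S = carrier G"
  proof
    show "generate G S \<subseteq> carrier G" using generate_incl[OF Sfin(2)] .
    have "T \<subseteq> generate G S"
    proof
      fix t assume "t \<in> T"
      then show "t \<in> generate G S"
        by (cases "t = \<one>") (auto simp: S_def intro: generate.one generate.incl)
    qed
    then have "generate G T \<subseteq> generate G S"
      by (rule generate_subgroup_incl[OF _ generate_is_subgroup[OF Sfin(2)]])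
    then show "carrier G \<subseteq> generate G S" by (simp add: genT)
  qed
  have cardS: "card A \<le> 2 * card S"
  proof -
    have "card (A - {\<one>}) \<le> card S" using Sfin by (intro card_mono) (auto simp: S_def)
    moreover have "card A \<le> card (A - {\<one>}) + 1" using A(1) by (auto simp: card_Diff_singleton_if)
    ultimately show ?thesis using A2 by linarith
  qed
  have Sne: "S \<noteq> {}" using cardS A2 by auto
  have bdS: "conv_bound (indicator S) c"
  proof (rule conv_bound_mono)
    show "conv_bound (indicator (T \<union> (A \<union> m_inv G ` A))) c"
      unfolding c_def
      by (intro conv_bound_indicator_Un bdT A conv_bound_indicator_inverse_image)
  qed (auto simp: S_def indicator_def)
  have c1: "1 \<le> c" using r a1 by (simp add: c_def)
  have cle: "c \<le> (real D + 2) * d * card A"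
  proof -
    have "c \<le> real D * 1 + 2 * (d * card A)" using r A(6) by (simp add: c_def)
    also have "\<dots> \<le> real D * (d * card A) + 2 * (d * card A)" using dA d0 by (intro add_mono mult_left_mono) auto
    finally show ?thesis by (simp add: algebra_simps)
  qed
  have lnS: "1 + ln (card S) \<le> (real D + 3) * (real k + 1)"
  proof -
    have "card S \<le> card (T \<union> (A \<union> m_inv G ` A))" using T A by (intro card_mono) (auto simp: S_def)
    also have "\<dots> \<le> card T + (card A + card (m_inv G ` A))"
      by (intro order.trans[OF card_Un_le] add_left_mono card_Un_le)
    also have "\<dots> \<le> D + 2 * D ^ k" using A(5) card_image_le[OF A(1), of "m_inv G"] by (simp add: D_def)
    also have "\<dots> \<le> 3 * D ^ (k + 1)"
    proof -
      have "D ^ k \<le> D ^ (k + 1)" using power_increasing[of k "k + 1" D] D by linarith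
      moreover have "D \<le> D ^ (k + 1)" using power_increasing[of 1 "k + 1" D] D by simp
      ultimately show ?thesis by linarith
    qed
    finally have "real (card S) \<le> 3 * real D ^ (k + 1)" by (metis of_nat_le_iff of_nat_mult of_nat_numeral of_nat_power)
    then have "ln (card S) \<le> ln (3 * real D ^ (k + 1))"
      using Sne Sfin by (subst ln_le_cancel_iff) (auto simp: card_gt_0_iff D)
    also have "\<dots> = ln 3 + (k + 1) * ln D" using D by (simp add: ln_mult ln_realpow algebra_simps)
    also have "\<dots> \<le> 2 + real (k + 1) * real D"
    proof (intro add_mono mult_left_mono)
      show "ln (3::real) \<le> 2" using ln_le_minus_one[of "3::real"] by simp
      show "ln (real D) \<le> D" using ln_le_minus_one[of "real D"] D by simp
    qed auto
    finally show ?thesis by (simp add: algebra_simps)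
  qed
  have "c * (1 + ln (card S)) \<le> ((real D + 2) * d * card A) * ((real D + 3) * (real k + 1))"
    using cle lnS c1 Sne Sfin d0
    by (intro mult_mono) (auto intro!: add_nonneg_nonneg ln_ge_zero simp: Suc_le_eq card_gt_0_iff)
  also have "\<dots> = ((real D + 2) * d * (2 * ((real D + 3) * (real k + 1)))) * (card A / 2)" by simp
  also have "\<dots> \<le> \<epsilon> * card S"
    using small(1) cardS eps by (intro mult_mono) auto
  finally have "c * (1 + ln (card S)) \<le> \<epsilon> * card S" .
  moreover have "finite_symmetric_generating_set G S"
    unfolding finite_symmetric_generating_set_alt using Sfin Ssym Sgen by blast
  ultimately show ?thesis using that[of S c] Sne bdS c1 by (auto simp: S_def)
qed

end

section \<open>Paths and open clusters\<close>

lemma pred_countable_Ball: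
  assumes "countable I" "\<And>i. i \<in> I \<Longrightarrow> Measurable.pred M (\<lambda>x. Q i x)"
  shows "Measurable.pred M (\<lambda>x. \<forall>i\<in>I. Q i x)"
  using assms unfolding pred_def by (intro sets.sets_Collect_countable_All') auto

lemma pred_countable_Bex:
  assumes "countable I" "\<And>i. i \<in> I \<Longrightarrow> Measurable.pred M (\<lambda>x. Q i x)"
  shows "Measurable.pred M (\<lambda>x. \<exists>i\<in>I. Q i x)"
  using assms unfolding pred_def by (intro sets.sets_Collect_countable_Ex') auto

context group
begin

lemma wprod_append:
  "set us \<subseteq> carrier G \<Longrightarrow> set ws \<subseteq> carrier G \<Longrightarrow> wprod (us @ ws) = wprod us \<otimes> wprod ws"
  by (induction us) (auto simp: m_assoc)

lemma carrier_eq_wprod: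
  assumes S: "S \<subseteq> carrier G" "\<And>s. s \<in> S \<Longrightarrow> inv s \<in> S" "generate G S = carrier G"
  shows "carrier G = wprod ` lists S"
proof
  show "carrier G \<subseteq> wprod ` lists S"
  proof
    fix x assume "x \<in> carrier G"
    then have "x \<in> generate G S" using S by simp
    then show "x \<in> wprod ` lists S"
    proof induction
      case one show ?case by (rule image_eqI[of _ _ "[]"]) auto
    next
      case (incl s) then show ?case using S by (intro image_eqI[of _ _ "[s]"]) auto
    next
      case (inv s) then show ?case using S by (intro image_eqI[of _ _ "[inv s]"]) auto
    next
      case (eng x y)
      then obtain us ws where "us \<in> lists S" "x = wprod us" "ws \<in> lists S" "y = wprod ws" by auto
      then show ?case using S
        by (intro image_eqI[of _ _ "us @ ws"]) (auto simp: wprod_append lists_eq_set)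
    qed
  qed
  show "wprod ` lists S \<subseteq> carrier G" using S by (auto simp: lists_eq_set)
qed

primrec path_verts :: "'a \<Rightarrow> 'a list \<Rightarrow> 'a list" where
  "path_verts x [] = [x]"
| "path_verts x (s # ws) = x # path_verts (x \<otimes> s) ws"

primrec path_edges :: "'a \<Rightarrow> 'a list \<Rightarrow> 'a set list" where
  "path_edges x [] = []"
| "path_edges x (s # ws) = {x, x \<otimes> s} # path_edges (x \<otimes> s) ws"

lemma length_path_edges [simp]: "length (path_edges x ws) = length ws"
  by (induction ws arbitrary: x) auto

lemma start_in_path_verts [simp]: "x \<in> set (path_verts x ws)"
  by (cases ws) auto

lemma path_edges_subset_verts: "e \<in> set (path_edges x ws) \<Longrightarrow> e \<subseteq> set (path_verts x ws)"
  by (induction ws arbitrary: x) auto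

lemma distinct_path_edges: "distinct (path_verts x ws) \<Longrightarrow> distinct (path_edges x ws)"
proof (induction ws arbitrary: x)
  case (Cons s ws)
  then have "x \<notin> set (path_verts (x \<otimes> s) ws)" by simp
  then have "{x, x \<otimes> s} \<notin> set (path_edges (x \<otimes> s) ws)" using path_edges_subset_verts by blast
  then show ?case using Cons by simp
qed simp

lemma path_verts_append:
  "x \<in> carrier G \<Longrightarrow> set us \<subseteq> carrier G \<Longrightarrow>
   set (path_verts x (us @ ws)) = set (path_verts x us) \<union> set (path_verts (x \<otimes> wprod us) ws)"
  by (induction us arbitrary: x) (auto simp: m_assoc)

lemma path_verts_split:
  assumes "x \<in> carrier G" "set ws \<subseteq> carrier G" "v \<in> set (path_verts x ws)"
  shows "\<exists>us vs. ws = us @ vs \<and> v = x \<otimes> wprod us"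
  using assms
proof (induction ws arbitrary: x)
  case (Cons s ws)
  show ?case
  proof (cases "v = x")
    case True then show ?thesis using Cons.prems by (intro exI[of _ "[]"] exI[of _ "s # ws"]) simp
  next
    case False
    then obtain us vs where "ws = us @ vs" "v = (x \<otimes> s) \<otimes> wprod us"
      using Cons.IH[of "x \<otimes> s"] Cons.prems by auto
    then show ?thesis using Cons.prems by (intro exI[of _ "s # us"] exI[of _ vs]) (auto simp: m_assoc)
  qed
qed auto

text \<open>
  Loop erasure: a path through \<open>v\<close> can be cut at \<open>v\<close>, which keeps it open, and keeps it simple if it was.
\<close>

lemma path_suffix:
  assumes "x \<in> carrier G" "set ws \<subseteq> carrier G" "v \<in> set (path_verts x ws)"
  obtains vs where "set vs \<subseteq> set ws" "v \<otimes> wprod vs = x \<otimes> wprod ws"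
    "set (path_edges v vs) \<subseteq> set (path_edges x ws)"
    "distinct (path_verts x ws) \<Longrightarrow> distinct (path_verts v vs)"
  using assms
proof (induction ws arbitrary: x thesis)
  case Nil
  show ?case by (rule Nil.prems(1)[of "[]"]) (use Nil.prems in auto)
next
  case (Cons s ws)
  show ?case
  proof (cases "v = x")
    case True show ?thesis by (rule Cons.prems(1)[of "s # ws"]) (use True in auto)
  next
    case False
    then have v: "v \<in> set (path_verts (x \<otimes> s) ws)" using Cons.prems by auto
    have xs: "x \<otimes> s \<in> carrier G" "set ws \<subseteq> carrier G" using Cons.prems by auto
    show ?thesis
    proof (rule Cons.IH[OF _ xs v])
      fix vs
      assume "set vs \<subseteq> set ws" "v \<otimes> wprod vs = x \<otimes> s \<otimes> wprod ws"
        "set (path_edges v vs) \<subseteq> set (path_edges (x \<otimes> s) ws)"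
        "distinct (path_verts (x \<otimes> s) ws) \<Longrightarrow> distinct (path_verts v vs)"
      then show ?thesis using Cons.prems(2,3) by (intro Cons.prems(1)[of vs]) (auto simp: m_assoc)
    qed
  qed
qed

lemma path_edges_translate:
  assumes "g \<in> carrier G" "x \<in> carrier G" "set ws \<subseteq> carrier G"
  shows "path_edges (g \<otimes> x) ws = map (image ((\<otimes>) g)) (path_edges x ws)"
  using assms by (induction ws arbitrary: x) (auto simp: m_assoc)

end

text \<open>
  Excluding \<open>\<one>\<close> from \<open>S\<close> makes every pair \<open>(x, s)\<close> a genuine edge, so that edges of a path correspond to
  letters of a word.
\<close>

locale cayley_percolation = group G for G :: "('a, 'b) monoid_scheme" (structure) +
  fixes S :: "'a set" and p :: real
  assumes finite_S: "finite S" and S_carrier: "S \<subseteq> carrier G"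
    and S_inv: "s \<in> S \<Longrightarrow> inv s \<in> S" and S_gen: "generate G S = carrier G"
    and one_notin_S: "\<one> \<notin> S"
    and p01: "0 \<le> p" "p \<le> 1"
begin

abbreviation E :: "'a set set" where "E \<equiv> cayley_edges G S"

abbreviation P :: "('a set \<Rightarrow> bool) measure" where "P \<equiv> bernoulli_percolation E p"

lemma S_closed [simp]: "s \<in> S \<Longrightarrow> s \<in> carrier G"
  using S_carrier by auto

lemma edge_iff: "{u, v} \<in> E \<longleftrightarrow> u \<in> carrier G \<and> v \<in> carrier G \<and> inv u \<otimes> v \<in> S"
proof
  assume "{u, v} \<in> E"
  then obtain g s where g: "g \<in> carrier G" "s \<in> S" "{u, v} = {g, g \<otimes> s}"
    by (auto simp: cayley_edges_def)
  from g(3) consider "u = g" "v = g \<otimes> s" | "u = g \<otimes> s" "v = g" by (auto simp: doubleton_eq_iff)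
  then show "u \<in> carrier G \<and> v \<in> carrier G \<and> inv u \<otimes> v \<in> S"
  proof cases
    case 1 then show ?thesis using g by (simp add: m_assoc[symmetric])
  next
    case 2
    have "inv (g \<otimes> s) \<otimes> g = inv s" using g by (simp add: inv_mult_group m_assoc)
    then show ?thesis using 2 g S_inv by simp
  qed
next
  assume uv: "u \<in> carrier G \<and> v \<in> carrier G \<and> inv u \<otimes> v \<in> S"
  then have "{u, v} = {u, u \<otimes> (inv u \<otimes> v)}" by (simp add: m_assoc[symmetric])
  moreover have "inv u \<otimes> v \<noteq> \<one>" using uv one_notin_S by metis
  ultimately show "{u, v} \<in> E"
    using uv unfolding cayley_edges_def by (intro CollectI exI[of _ u] exI[of _ "inv u \<otimes> v"]) simp
qed

lemma edge_mult [simp]: "x \<in> carrier G \<Longrightarrow> s \<in> S \<Longrightarrow> {x, x \<otimes> s} \<in> E"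
  by (simp add: edge_iff m_assoc[symmetric])

lemma path_edges_in_E: "x \<in> carrier G \<Longrightarrow> set ws \<subseteq> S \<Longrightarrow> set (path_edges x ws) \<subseteq> E"
  by (induction ws arbitrary: x) auto

lemma words_carrier: "set ws \<subseteq> S \<Longrightarrow> set ws \<subseteq> carrier G"
  using S_carrier by auto

lemma countable_carrier: "countable (carrier G)"
  using carrier_eq_wprod[OF S_carrier S_inv S_gen] finite_S
  by (metis countable_finite countable_image countable_lists)

lemma E_eq: "E = (\<lambda>(x, s). {x, x \<otimes> s}) ` (carrier G \<times> S)"
  using one_notin_S by (auto simp: cayley_edges_def)

lemma countable_E: "countable E"
  unfolding E_eq
  by (intro countable_image countable_SIGMA countable_carrier countable_finite[OF finite_S])

definition conn :: "('a set \<Rightarrow> bool) \<Rightarrow> ('a \<times> 'a) set" where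
  "conn \<omega> = {(u, v). {u, v} \<in> {e \<in> E. \<omega> e}}\<^sup>*"

definition cluster :: "('a set \<Rightarrow> bool) \<Rightarrow> 'a \<Rightarrow> 'a set" where
  "cluster \<omega> x = {y \<in> carrier G. (x, y) \<in> conn \<omega>}"

lemma conn_trans: "(x, y) \<in> conn \<omega> \<Longrightarrow> (y, z) \<in> conn \<omega> \<Longrightarrow> (x, z) \<in> conn \<omega>"
  unfolding conn_def by (rule rtrancl_trans)

lemma conn_refl [simp]: "(x, x) \<in> conn \<omega>"
  by (simp add: conn_def)

lemma conn_edge: "{x, y} \<in> E \<Longrightarrow> \<omega> {x, y} \<Longrightarrow> (x, y) \<in> conn \<omega>"
  by (auto simp: conn_def)

lemma cayley_clusters_eq: "cayley_clusters G S \<omega> = cluster \<omega> ` carrier G"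
  unfolding cayley_clusters_def clusters_def quotient_def cluster_def conn_def by auto

lemma conn_path:
  assumes "x \<in> carrier G" "set ws \<subseteq> S" "\<forall>e\<in>set (path_edges x ws). \<omega> e"
  shows "(x, x \<otimes> wprod ws) \<in> conn \<omega>"
  using assms
proof (induction ws arbitrary: x)
  case (Cons s ws)
  have "(x, x \<otimes> s) \<in> conn \<omega>" using Cons.prems by (intro conn_edge) auto
  moreover have "(x \<otimes> s, x \<otimes> s \<otimes> wprod ws) \<in> conn \<omega>" using Cons.prems by (intro Cons.IH) auto
  ultimately have "(x, x \<otimes> s \<otimes> wprod ws) \<in> conn \<omega>" by (rule conn_trans)
  moreover have "x \<otimes> s \<otimes> wprod ws = x \<otimes> wprod (s # ws)"
    using Cons.prems words_carrier[of ws] by (simp add: m_assoc)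
  ultimately show ?case by simp
qed simp

text \<open>
  Simple paths are needed because their edges are distinct, which makes the probability that all of
  them are open equal to \<open>p\<close> to the power of the length.
\<close>

lemma conn_simple_path:
  assumes "(x, y) \<in> conn \<omega>" "y \<in> carrier G"
  shows "x \<in> carrier G \<and> (\<exists>ws. set ws \<subseteq> S \<and> x \<otimes> wprod ws = y \<and>
    (\<forall>e\<in>set (path_edges x ws). \<omega> e) \<and> distinct (path_verts x ws))"
  using assms(1) unfolding conn_def
proof (induction rule: converse_rtrancl_induct)
  case base
  show ?case using assms(2) by (intro conjI exI[of _ "[]"]) auto
next
  case (step x z)
  then obtain ws where ws: "z \<in> carrier G" "set ws \<subseteq> S" "z \<otimes> wprod ws = y"
    "\<forall>e\<in>set (path_edges z ws). \<omega> e" "distinct (path_verts z ws)" by blast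
  from step.hyps(1) have xz: "x \<in> carrier G" "inv x \<otimes> z \<in> S" "\<omega> {x, z}"
    by (auto simp: edge_iff)
  have z: "x \<otimes> (inv x \<otimes> z) = z" using xz ws(1) by (simp add: m_assoc[symmetric])
  show ?case
  proof (cases "x \<in> set (path_verts z ws)")
    case True
    obtain vs where "set vs \<subseteq> set ws" "x \<otimes> wprod vs = z \<otimes> wprod ws"
      "set (path_edges x vs) \<subseteq> set (path_edges z ws)"
      "distinct (path_verts z ws) \<Longrightarrow> distinct (path_verts x vs)"
      using path_suffix[OF ws(1) words_carrier[OF ws(2)] True] by metis
    then show ?thesis using xz ws by (intro conjI exI[of _ vs]) auto
  next
    case False
    have "x \<otimes> wprod ((inv x \<otimes> z) # ws) = x \<otimes> (inv x \<otimes> z) \<otimes> wprod ws"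
      using xz ws(2) words_carrier by (simp add: m_assoc)
    then show ?thesis using xz ws z False
      by (intro conjI exI[of _ "(inv x \<otimes> z) # ws"]) auto
  qed
qed

lemma conn_iff_path:
  assumes "x \<in> carrier G" "y \<in> carrier G"
  shows "(x, y) \<in> conn \<omega> \<longleftrightarrow>
    (\<exists>ws\<in>lists S. x \<otimes> wprod ws = y \<and> (\<forall>e\<in>set (path_edges x ws). \<omega> e))"
  using conn_simple_path[of x y \<omega>] conn_path[of x _ \<omega>] assms
  by (auto simp: lists_eq_set)

sublocale PP: product_prob_space "\<lambda>_. measure_pmf (bernoulli_pmf p)" E
  by unfold_locales

lemma P_eq: "P = PiM E (\<lambda>_. measure_pmf (bernoulli_pmf p))"
  by (simp add: bernoulli_percolation_def)

sublocale prob_space P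
  unfolding P_eq by (rule PP.prob_space_axioms)

lemma prob_cylinder:
  assumes "J \<subseteq> E" "finite J"
  shows "prob {\<omega> \<in> space P. \<forall>e\<in>J. \<omega> e = b} = (pmf (bernoulli_pmf p) b) ^ card J"
proof -
  have "{\<omega> \<in> space P. \<forall>e\<in>J. \<omega> e = b}
      = prod_emb E (\<lambda>_. measure_pmf (bernoulli_pmf p)) J (PiE J (\<lambda>_. {b}))"
    by (rule Set.set_eqI)
       (simp only: prod_emb_iff restrict_PiE_iff mem_Collect_eq P_eq space_PiM PiE_iff singleton_iff,
        simp add: extensional_def)
  then show ?thesis
    unfolding P_eq using PP.measure_PiM_emb[OF assms, of "\<lambda>_. {b}"] by (simp add: measure_pmf_single)
qed

lemma prob_open: "J \<subseteq> E \<Longrightarrow> finite J \<Longrightarrow> prob {\<omega> \<in> space P. \<forall>e\<in>J. \<omega> e} = p ^ card J"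
  using prob_cylinder[of J True] p01 by simp

lemma prob_closed: "J \<subseteq> E \<Longrightarrow> finite J \<Longrightarrow> prob {\<omega> \<in> space P. \<forall>e\<in>J. \<not> \<omega> e} = (1 - p) ^ card J"
  using prob_cylinder[of J False] p01 by simp

lemma pred_open [measurable (raw)]: "e \<in> E \<Longrightarrow> Measurable.pred P (\<lambda>\<omega>. \<omega> e)"
  unfolding P_eq using measurable_component_singleton[of e E "\<lambda>_. measure_pmf (bernoulli_pmf p)"]
  by simp

lemma pred_conn:
  assumes "x \<in> carrier G" "y \<in> carrier G"
  shows "Measurable.pred P (\<lambda>\<omega>. (x, y) \<in> conn \<omega>)"
  unfolding conn_iff_path[OF assms]
proof (intro pred_countable_Bex)
  show "countable (lists S)" using finite_S by (intro countable_lists countable_finite)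
  fix ws assume ws: "ws \<in> lists S"
  have "Measurable.pred P (\<lambda>\<omega>. \<forall>e\<in>set (path_edges x ws). \<omega> e)"
    using path_edges_in_E[OF assms(1), of ws] ws
    by (intro pred_intros_finite pred_open) (auto simp: lists_eq_set)
  then show "Measurable.pred P (\<lambda>\<omega>. x \<otimes> wprod ws = y \<and> (\<forall>e\<in>set (path_edges x ws). \<omega> e))"
    by simp
qed

text \<open>
  A cluster is infinite iff it escapes every finite set of vertices, and there are only countably many of those.
\<close>

lemma pred_infinite_cluster:
  assumes "x \<in> carrier G"
  shows "Measurable.pred P (\<lambda>\<omega>. infinite (cluster \<omega> x))"
proof -
  have "infinite (cluster \<omega> x) \<longleftrightarrow> (\<forall>F\<in>Fpow (carrier G). \<exists>y\<in>carrier G - F. (x, y) \<in> conn \<omega>)" for \<omega>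
  proof
    assume inf: "infinite (cluster \<omega> x)"
    show "\<forall>F\<in>Fpow (carrier G). \<exists>y\<in>carrier G - F. (x, y) \<in> conn \<omega>"
    proof
      fix F assume "F \<in> Fpow (carrier G)"
      then have "\<not> cluster \<omega> x \<subseteq> F" using inf by (auto simp: Fpow_def finite_subset)
      then show "\<exists>y\<in>carrier G - F. (x, y) \<in> conn \<omega>" by (auto simp: cluster_def)
    qed
  next
    assume R: "\<forall>F\<in>Fpow (carrier G). \<exists>y\<in>carrier G - F. (x, y) \<in> conn \<omega>"
    show "infinite (cluster \<omega> x)"
    proof
      assume "finite (cluster \<omega> x)"
      then have "cluster \<omega> x \<in> Fpow (carrier G)" by (auto simp: Fpow_def cluster_def)
      with R show False by (auto simp: cluster_def)
    qed
  qed
  moreover have "Measurable.pred P (\<lambda>\<omega>. \<forall>F\<in>Fpow (carrier G). \<exists>y\<in>carrier G - F. (x, y) \<in> conn \<omega>)"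
    using countable_carrier assms
    by (intro pred_countable_Ball pred_countable_Bex pred_conn countable_Fpow countable_Diff) auto
  ultimately show ?thesis by simp
qed

end

section \<open>The Peierls argument\<close>

context cayley_percolation
begin

text \<open>
  The finite connected vertex sets of the Cayley graph that contain \<open>\<one>\<close>, presented by growing them one
  vertex at a time (lattice animals).
\<close>

inductive animal :: "'a set \<Rightarrow> bool" where
  animal_one: "animal {\<one>}"
| animal_insert: "animal C \<Longrightarrow> v \<in> C \<Longrightarrow> s \<in> S \<Longrightarrow> v \<otimes> s \<notin> C \<Longrightarrow> animal (insert (v \<otimes> s) C)"

lemma animal_finite_carrier: "animal C \<Longrightarrow> finite C \<and> C \<subseteq> carrier G \<and> \<one> \<in> C"
  by (induction rule: animal.induct) auto

text \<open>
  A walk around a spanning tree: whenever a vertex \<open>v \<otimes> s\<close> is added, the detour \<open>s, inv s\<close> is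
  inserted at a visit to \<open>v\<close>. This encodes animals by words and so allows counting them.
\<close>

lemma animal_walk:
  "animal C \<Longrightarrow> \<exists>ws. set ws \<subseteq> S \<and> length ws + 2 = 2 * card C \<and> set (path_verts \<one> ws) = C"
proof (induction rule: animal.induct)
  case animal_one
  show ?case by (intro exI[of _ "[]"]) auto
next
  case (animal_insert C v s)
  then obtain ws where ws: "set ws \<subseteq> S" "length ws + 2 = 2 * card C" "set (path_verts \<one> ws) = C" by blast
  obtain us vs where uv: "ws = us @ vs" "v = \<one> \<otimes> wprod us"
    using path_verts_split[of \<one> ws v] ws animal_insert.hyps words_carrier by auto
  have c: "set us \<subseteq> S" "set vs \<subseteq> S" using ws uv by auto
  then have c': "set us \<subseteq> carrier G" "set vs \<subseteq> carrier G" using words_carrier by auto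
  have v: "v = wprod us" "v \<in> carrier G" using uv c' by auto
  let ?ws = "us @ [s, inv s] @ vs"
  have s: "s \<in> carrier G" "inv s \<in> S" using animal_insert.hyps S_inv by auto
  have ret: "v \<otimes> s \<otimes> inv s = v" using v s by (simp add: m_assoc)
  have "set (path_verts \<one> ?ws) = set (path_verts \<one> us) \<union> set (path_verts v ([s, inv s] @ vs))"
    using path_verts_append[of \<one> us "[s, inv s] @ vs"] c' v by simp
  also have "set (path_verts v ([s, inv s] @ vs)) = insert (v \<otimes> s) (set (path_verts v vs))"
    using ret by auto
  also have "set (path_verts \<one> us) \<union> insert (v \<otimes> s) (set (path_verts v vs)) =
      insert (v \<otimes> s) (set (path_verts \<one> ws))"
    using path_verts_append[of \<one> us vs] c' v uv by auto
  finally have "set (path_verts \<one> ?ws) = insert (v \<otimes> s) C" using ws by simp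
  moreover have "length ?ws + 2 = 2 * card (insert (v \<otimes> s) C)"
    using ws(2) uv(1) animal_insert.hyps animal_finite_carrier by simp
  moreover have "set ?ws \<subseteq> S" using c s animal_insert.hyps by auto
  ultimately show ?case by blast
qed

lemma card_animals:
  assumes "S \<noteq> {}"
  shows "finite {C. animal C \<and> card C = n}"
    and "card {C. animal C \<and> card C = n} \<le> card S ^ (2 * n)"
proof -
  let ?L = "{ws. set ws \<subseteq> S \<and> length ws = 2 * n - 2}"
  have L: "finite ?L" "card ?L = card S ^ (2 * n - 2)"
    using finite_S by (auto simp: finite_lists_length_eq card_lists_length_eq)
  have sub: "{C. animal C \<and> card C = n} \<subseteq> (\<lambda>ws. set (path_verts \<one> ws)) ` ?L"
  proof
    fix C assume C: "C \<in> {C. animal C \<and> card C = n}"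
    then obtain ws where "set ws \<subseteq> S" "length ws + 2 = 2 * n" "set (path_verts \<one> ws) = C"
      using animal_walk[of C] by auto
    then show "C \<in> (\<lambda>ws. set (path_verts \<one> ws)) ` ?L" by (intro image_eqI[of _ _ ws]) auto
  qed
  show "finite {C. animal C \<and> card C = n}"
    using finite_subset[OF sub] L by blast
  have "card {C. animal C \<and> card C = n} \<le> card ((\<lambda>ws. set (path_verts \<one> ws)) ` ?L)"
    using sub L by (intro card_mono) auto
  also have "\<dots> \<le> card S ^ (2 * n - 2)" using card_image_le[OF L(1)] L(2) by metis
  also have "\<dots> \<le> card S ^ (2 * n)"
    using assms finite_S by (intro power_increasing) (auto simp: Suc_le_eq card_gt_0_iff)
  finally show "card {C. animal C \<and> card C = n} \<le> card S ^ (2 * n)" .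
qed

lemma animal_extend:
  assumes "finite D" "K \<subseteq> D" "animal K"
    and "\<And>C. animal C \<Longrightarrow> K \<subseteq> C \<Longrightarrow> C \<subset> D \<Longrightarrow> \<exists>v\<in>C. \<exists>s\<in>S. v \<otimes> s \<in> D - C"
  shows "animal D"
  using assms
proof (induction "card (D - K)" arbitrary: K rule: less_induct)
  case less
  show ?case
  proof (cases "K = D")
    case False
    then obtain v s where vs: "v \<in> K" "s \<in> S" "v \<otimes> s \<in> D - K"
      using less.prems(2-4) by blast
    let ?K = "insert (v \<otimes> s) K"
    show ?thesis
    proof (rule less.hyps[of ?K])
      have "D - ?K \<subset> D - K" using vs by auto
      then show "card (D - ?K) < card (D - K)" using less.prems(1) by (intro psubset_card_mono) auto
      show "?K \<subseteq> D" using vs less.prems(2) by auto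
      show "animal ?K" using vs less.prems(3) by (intro animal_insert) auto
    next
      fix C assume "animal C" "?K \<subseteq> C" "C \<subset> D"
      then show "\<exists>v\<in>C. \<exists>s\<in>S. v \<otimes> s \<in> D - C" using less.prems(4)[of C] by simp
    qed (rule less.prems(1))
  qed (use less.prems in simp)
qed

definition edge_boundary :: "'a set \<Rightarrow> 'a set set" where
  "edge_boundary C = (\<lambda>(x, s). {x, x \<otimes> s}) ` out_pairs S C"

text \<open>
  The pair is recovered from the edge, because exactly one endpoint of a boundary edge lies in \<open>C\<close>.
\<close>

lemma edge_boundary:
  assumes "finite C" "C \<subseteq> carrier G"
  shows "finite (edge_boundary C)" "edge_boundary C \<subseteq> E" "card (edge_boundary C) = card (out_pairs S C)"
proof -
  show "finite (edge_boundary C)"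
    unfolding edge_boundary_def using assms finite_S finite_out_pairs by auto
  show "edge_boundary C \<subseteq> E"
    using assms by (auto simp: edge_boundary_def out_pairs_def)
  have "inj_on (\<lambda>(x, s). {x, x \<otimes> s}) (out_pairs S C)"
  proof (rule inj_onI, clarify)
    fix x s y t
    assume xs: "(x, s) \<in> out_pairs S C" and yt: "(y, t) \<in> out_pairs S C" and eq: "{x, x \<otimes> s} = {y, y \<otimes> t}"
    have in_C: "x \<in> C" "x \<otimes> s \<notin> C" "y \<in> C" "y \<otimes> t \<notin> C" "s \<in> S" "t \<in> S"
      using xs yt by (auto simp: out_pairs_def)
    then have "x = y" "x \<otimes> s = y \<otimes> t" using eq by (auto simp: doubleton_eq_iff)
    then show "x = y \<and> s = t" using in_C assms by auto
  qed
  then show "card (edge_boundary C) = card (out_pairs S C)"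
    unfolding edge_boundary_def by (rule card_image)
qed

lemma conn_crosses:
  assumes "(x, y) \<in> conn \<omega>" "x \<in> C" "y \<notin> C"
  shows "\<exists>u v. (x, u) \<in> conn \<omega> \<and> {u, v} \<in> E \<and> \<omega> {u, v} \<and> u \<in> C \<and> v \<notin> C"
  using assms unfolding conn_def
proof (induction rule: rtrancl_induct)
  case (step y z)
  show ?case
  proof (cases "y \<in> C")
    case True then show ?thesis using step by blast
  next
    case False then show ?thesis using step by blast
  qed
qed simp

lemma edge_neighbor:
  assumes "{u, v} \<in> E"
  obtains s where "s \<in> S" "v = u \<otimes> s" "u \<in> carrier G" "v \<in> carrier G"
proof -
  have "u \<in> carrier G" "v \<in> carrier G" "inv u \<otimes> v \<in> S" using assms by (auto simp: edge_iff)
  then show ?thesis using that[of "inv u \<otimes> v"] by (simp add: m_assoc[symmetric])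
qed

text \<open>
  The union of the clusters of all vertices of \<open>K\<close> has no open boundary edge. It is an animal although
  the clusters need not be connected to each other by open paths, since they are all attached to the animal \<open>K\<close>.
\<close>

lemma closed_animal_if_finite_clusters:
  assumes fin: "\<And>x. x \<in> carrier G \<Longrightarrow> finite (cluster \<omega> x)" and K: "animal K"
  obtains D where "animal D" "K \<subseteq> D" "\<forall>e\<in>edge_boundary D. \<not> \<omega> e"
proof -
  define D where "D = (\<Union>x\<in>K. cluster \<omega> x)"
  have Kc: "finite K" "K \<subseteq> carrier G" using animal_finite_carrier[OF K] by auto
  have D: "finite D" "D \<subseteq> carrier G" using Kc fin by (auto simp: D_def cluster_def)
  have KD: "K \<subseteq> D" using Kc by (auto simp: D_def cluster_def)
  have closed: "v \<in> D" if "u \<in> D" "{u, v} \<in> E" "\<omega> {u, v}" for u v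
  proof -
    obtain x where x: "x \<in> K" "(x, u) \<in> conn \<omega>" using \<open>u \<in> D\<close> by (auto simp: D_def cluster_def)
    have "(x, v) \<in> conn \<omega>" using x(2) conn_edge[of u v \<omega>, OF that(2,3)] by (rule conn_trans)
    moreover have "v \<in> carrier G" using that(2) by (simp add: edge_iff)
    ultimately show ?thesis using x(1) by (auto simp: D_def cluster_def)
  qed
  have "animal D"
  proof (rule animal_extend[OF D(1) KD K])
    fix C assume C: "animal C" "K \<subseteq> C" "C \<subset> D"
    then obtain w where w: "w \<in> D" "w \<notin> C" by auto
    then obtain x where x: "x \<in> K" "(x, w) \<in> conn \<omega>" by (auto simp: D_def cluster_def)
    obtain u v where uv: "{u, v} \<in> E" "\<omega> {u, v}" "u \<in> C" "v \<notin> C"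
      using conn_crosses[OF x(2), of C] x(1) C(2) w(2) by auto
    obtain s where "s \<in> S" "v = u \<otimes> s" using edge_neighbor[OF uv(1)] by metis
    moreover have "v \<in> D" using closed[OF _ uv(1,2)] uv(3) C(3) by auto
    ultimately show "\<exists>v\<in>C. \<exists>s\<in>S. v \<otimes> s \<in> D - C" using uv by blast
  qed
  moreover have "\<forall>e\<in>edge_boundary D. \<not> \<omega> e"
  proof (unfold edge_boundary_def, clarify)
    fix x s assume "(x, s) \<in> out_pairs S D" "\<omega> {x, x \<otimes> s}"
    then show False using closed[of x "x \<otimes> s"] D(2) by (auto simp: out_pairs_def subset_iff)
  qed
  ultimately show ?thesis using KD that by blast
qed

text \<open>
  Peierls' argument. An animal \<open>C\<close> of size \<open>n\<close> has at least \<open>n * d / 2\<close> boundary edges, where \<open>d = card S\<close>.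
  They are all closed with probability at most \<open>exp (- p * d * n / 2) \<le> exp (- n) / d ^ (2 * n)\<close>, and
  there are at most \<open>d ^ (2 * n)\<close> such animals. By the Borel-Cantelli lemma almost surely only finitely
  many sizes of animals with closed boundary occur. But if all clusters were finite, arbitrarily large
  animals with closed boundary would exist. Starting from large animals rather than from a single vertex
  is what gives existence with probability one, not merely positive probability.
\<close>

lemma AE_infinite_cluster:
  fixes c :: real
  assumes bd: "conv_bound (indicator S) c" and Sne: "S \<noteq> {}" and c: "c \<le> card S / 2"
    and p: "4 * ln (card S) + 2 \<le> p * card S"
  shows "AE \<omega> in P. \<exists>C. C \<in> cayley_clusters G S \<omega> \<and> infinite C"
proof -
  define d where "d = card S"
  have d: "d > 0" using Sne finite_S by (simp add: d_def card_gt_0_iff)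
  define Cl where "Cl C = {\<omega> \<in> space P. \<forall>e\<in>edge_boundary C. \<not> \<omega> e}" for C
  define A where "A n = (\<Union>C\<in>{C. animal C \<and> card C = n}. Cl C)" for n
  have out: "d / 2 * card C \<le> card (out_pairs S C)" if "animal C" for C
  proof -
    have "d / 2 * card C \<le> (d - c) * card C" using c by (intro mult_right_mono) (auto simp: d_def)
    also have "\<dots> \<le> card (out_pairs S C)"
      using out_pairs_lower_bound[OF finite_S S_carrier bd] animal_finite_carrier[OF that] by (simp add: d_def)
    finally show ?thesis .
  qed
  have Cl_sets: "Cl C \<in> events" if "animal C" for C
  proof -
    have "Measurable.pred P (\<lambda>\<omega>. \<forall>e\<in>edge_boundary C. \<not> \<omega> e)"
      using edge_boundary[of C] animal_finite_carrier[OF that]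
      by (intro pred_intros_finite pred_intros_logic pred_open) auto
    then show ?thesis by (simp add: Cl_def pred_def)
  qed
  have prob_Cl: "prob (Cl C) \<le> exp (- 1) ^ card C / d ^ (2 * card C)" if "animal C" for C
  proof -
    have bC: "finite (edge_boundary C)" "edge_boundary C \<subseteq> E" "card (edge_boundary C) = card (out_pairs S C)"
      using edge_boundary animal_finite_carrier[OF that] by auto
    have "prob (Cl C) = (1 - p) ^ card (out_pairs S C)"
      unfolding Cl_def bC(3)[symmetric] by (rule prob_closed) (use bC in auto)
    also have "\<dots> \<le> exp (- p) ^ card (out_pairs S C)"
      using exp_ge_add_one_self[of "- p"] p01 by (intro power_mono) auto
    also have "\<dots> = exp (- (p * card (out_pairs S C)))"
      by (simp add: exp_of_nat_mult[symmetric] mult.commute)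
    also have "\<dots> \<le> exp (- ((2 * ln d + 1) * card C))"
    proof -
      have "(2 * ln d + 1) * card C \<le> (p * d / 2) * card C"
        using p by (intro mult_right_mono) (auto simp: d_def)
      also have "\<dots> = p * (d / 2 * card C)" by simp
      also have "\<dots> \<le> p * card (out_pairs S C)" using out[OF that] p01 by (intro mult_left_mono) auto
      finally show ?thesis by simp
    qed
    also have "\<dots> = exp (- real (card C)) / exp (real (2 * card C) * ln d)"
      by (simp add: exp_diff[symmetric] algebra_simps)
    also have "exp (real (2 * card C) * ln d) = d ^ (2 * card C)"
      using d unfolding exp_of_nat_mult by simp
    also have "exp (- real (card C)) = exp (- 1) ^ card C"
      by (simp add: exp_of_nat_mult[symmetric])
    finally show ?thesis .
  qed
  have A_sets: "A n \<in> events" for n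
    unfolding A_def using Cl_sets card_animals(1)[OF Sne] by (intro sets.finite_UN) auto
  have prob_A: "prob (A n) \<le> exp (- 1) ^ n" for n
  proof -
    have "prob (A n) \<le> (\<Sum>C\<in>{C. animal C \<and> card C = n}. prob (Cl C))"
      unfolding A_def using Cl_sets card_animals(1)[OF Sne] by (intro finite_measure_subadditive_finite) auto
    also have "\<dots> \<le> (\<Sum>C\<in>{C. animal C \<and> card C = n}. exp (- 1) ^ n / d ^ (2 * n))"
      using prob_Cl by (intro sum_mono) auto
    also have "\<dots> = card {C. animal C \<and> card C = n} * (exp (- 1) ^ n / d ^ (2 * n))" by simp
    also have "\<dots> \<le> d ^ (2 * n) * (exp (- 1) ^ n / d ^ (2 * n))"
      using card_animals(2)[OF Sne, of n] by (intro mult_right_mono) (auto simp: d_def)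
    also have "\<dots> = exp (- 1) ^ n" using d by simp
    finally show ?thesis .
  qed
  have "summable (\<lambda>n. exp (- 1 :: real) ^ n)" by (rule summable_geometric) simp
  then have "summable (\<lambda>n. prob (A n))"
    by (rule summable_comparison_test'[where N = 0]) (use prob_A in auto)
  then have "AE \<omega> in P. eventually (\<lambda>n. \<omega> \<in> space P - A n) sequentially"
    using A_sets by (intro borel_cantelli_AE1) (auto simp: emeasure_eq_measure)
  then show ?thesis
  proof eventually_elim
    fix \<omega> assume ev: "eventually (\<lambda>n. \<omega> \<in> space P - A n) sequentially"
    then obtain N where N: "\<And>n. N \<le> n \<Longrightarrow> \<omega> \<in> space P - A n" by (auto simp: eventually_sequentially)
    show "\<exists>C. C \<in> cayley_clusters G S \<omega> \<and> infinite C"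
    proof (rule ccontr)
      assume "\<not> ?thesis"
      then have fin: "finite (cluster \<omega> x)" if "x \<in> carrier G" for x
        using that by (auto simp: cayley_clusters_eq)
      have "\<exists>K. animal K \<and> card K = Suc n" for n
      proof (induction n)
        case 0 show ?case using animal_one by (intro exI[of _ "{\<one>}"]) auto
      next
        case (Suc n)
        then obtain K where K: "animal K" "card K = Suc n" by blast
        have "0 < d / 2 * card K" using d K by simp
        then have "out_pairs S K \<noteq> {}" using out[OF K(1)] by auto
        then obtain v s where "v \<in> K" "s \<in> S" "v \<otimes> s \<notin> K" by (auto simp: out_pairs_def)
        then have "animal (insert (v \<otimes> s) K)" "card (insert (v \<otimes> s) K) = Suc (Suc n)"
          using K animal_finite_carrier[of K] by (auto intro: animal_insert)
        then show ?case by blast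
      qed
      then obtain K where K: "animal K" "card K = Suc N" by blast
      obtain D where D: "animal D" "K \<subseteq> D" "\<forall>e\<in>edge_boundary D. \<not> \<omega> e"
        using closed_animal_if_finite_clusters[OF fin K(1)] by metis
      have "card K \<le> card D" using D animal_finite_carrier[of D] by (intro card_mono) auto
      then have "N \<le> card D" using K by simp
      then have "\<omega> \<in> space P - A (card D)" by (rule N)
      then show False using D by (auto simp: A_def Cl_def)
    qed
  qed
qed

end

section \<open>Non-uniqueness below the inverse norm\<close>

context cayley_percolation
begin

text \<open>
  A union bound over the simple paths from \<open>x\<close> to \<open>y\<close>: there are at most \<open>c ^ m\<close> of length \<open>m\<close>, each open with
  probability \<open>p ^ m\<close>, and none is shorter than \<open>N\<close>.
\<close>

lemma prob_conn_le:
  fixes c :: real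
  assumes xy: "x \<in> carrier G" "y \<in> carrier G"
    and bd: "conv_bound (indicator S) c" and c: "0 \<le> c" "p * c < 1"
    and far: "\<And>m. m < N \<Longrightarrow> words S m (inv x \<otimes> y) = {}"
  shows "prob {\<omega> \<in> space P. (x, y) \<in> conn \<omega>} \<le> (p * c) ^ N / (1 - p * c)"
proof -
  define Op where "Op ws = {\<omega> \<in> space P. \<forall>e\<in>set (path_edges x ws). \<omega> e}" for ws
  define W where "W m = {ws \<in> words S (m + N) (inv x \<otimes> y). distinct (path_edges x ws)}" for m
  define B where "B m = (\<Union>ws\<in>W m. Op ws)" for m
  have finW: "finite (W m)" for m unfolding W_def using finite_words[OF finite_S] by auto
  have path_E: "set (path_edges x ws) \<subseteq> E" if "ws \<in> W m" for ws m
    using that path_edges_in_E[OF xy(1)] by (auto simp: W_def words_def)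
  have Op_sets: "Op ws \<in> events" if "ws \<in> W m" for ws m
  proof -
    have "Measurable.pred P (\<lambda>\<omega>. \<forall>e\<in>set (path_edges x ws). \<omega> e)"
      using path_E[OF that] by (intro pred_intros_finite pred_open) auto
    then show ?thesis by (simp add: Op_def pred_def)
  qed
  have prob_Op: "prob (Op ws) = p ^ (m + N)" if "ws \<in> W m" for ws m
  proof -
    have "card (set (path_edges x ws)) = m + N"
      using that distinct_card[of "path_edges x ws"] by (auto simp: W_def words_def)
    then show ?thesis unfolding Op_def using path_E[OF that] by (simp add: prob_open)
  qed
  have B_sets: "B m \<in> events" for m unfolding B_def using Op_sets finW by (intro sets.finite_UN) auto
  have prob_B: "prob (B m) \<le> (p * c) ^ N * (p * c) ^ m" for m
  proof -
    have "prob (B m) \<le> (\<Sum>ws\<in>W m. prob (Op ws))"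
      unfolding B_def using Op_sets finW by (intro finite_measure_subadditive_finite) auto
    also have "\<dots> = card (W m) * p ^ (m + N)" using prob_Op by simp
    also have "\<dots> \<le> c ^ (m + N) * p ^ (m + N)"
    proof (intro mult_right_mono)
      have "card (W m) \<le> card (words S (m + N) (inv x \<otimes> y))"
        unfolding W_def using finite_words[OF finite_S] by (intro card_mono) auto
      then have "real (card (W m)) \<le> card (words S (m + N) (inv x \<otimes> y))" by simp
      also have "\<dots> \<le> c ^ (m + N)"
        using xy by (intro card_words_le[OF finite_S S_carrier c(1) bd]) auto
      finally show "real (card (W m)) \<le> c ^ (m + N)" .
    qed (use p01 in auto)
    also have "\<dots> = (p * c) ^ N * (p * c) ^ m" by (simp add: power_add power_mult_distrib mult_ac)
    finally show ?thesis .
  qed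
  have pc0: "0 \<le> p * c" using p01 c by simp
  have sums: "(\<lambda>m. (p * c) ^ N * (p * c) ^ m) sums ((p * c) ^ N * (1 / (1 - p * c)))"
    using pc0 c by (intro sums_mult geometric_sums) auto
  have summ: "summable (\<lambda>m. prob (B m))"
    by (rule summable_comparison_test'[OF sums_summable[OF sums], where N = 0]) (use prob_B in auto)
  have "{\<omega> \<in> space P. (x, y) \<in> conn \<omega>} \<subseteq> (\<Union>m. B m)"
  proof
    fix \<omega> assume \<omega>: "\<omega> \<in> {\<omega> \<in> space P. (x, y) \<in> conn \<omega>}"
    then obtain ws where ws: "set ws \<subseteq> S" "x \<otimes> wprod ws = y"
      "\<forall>e\<in>set (path_edges x ws). \<omega> e" "distinct (path_verts x ws)"
      using conn_simple_path[of x y \<omega>] xy by auto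
    have "wprod ws = inv x \<otimes> y"
      using ws(1,2) xy words_carrier[OF ws(1)] by (auto simp: m_assoc[symmetric])
    then have w: "ws \<in> words S (length ws) (inv x \<otimes> y)" using ws by (simp add: words_def)
    then have "N \<le> length ws" using far[of "length ws"] by (force simp: not_le[symmetric])
    then have "ws \<in> W (length ws - N)" using w distinct_path_edges[OF ws(4)] by (simp add: W_def)
    then have "\<omega> \<in> B (length ws - N)" using \<omega> ws(3) by (auto simp: B_def Op_def)
    then show "\<omega> \<in> (\<Union>m. B m)" by blast
  qed
  then have "prob {\<omega> \<in> space P. (x, y) \<in> conn \<omega>} \<le> prob (\<Union>m. B m)"
    using B_sets by (intro finite_measure_mono) auto
  also have "\<dots> \<le> (\<Sum>m. prob (B m))"
    using B_sets summ by (intro finite_measure_subadditive_countably) auto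
  also have "\<dots> \<le> (\<Sum>m. (p * c) ^ N * (p * c) ^ m)"
    by (rule suminf_le[OF prob_B summ sums_summable[OF sums]])
  also have "\<dots> = (p * c) ^ N / (1 - p * c)" using sums by (simp add: sums_iff)
  finally show ?thesis .
qed

text \<open>
  The action of \<open>G\<close> on configurations. The restriction to edges puts the result into the space of the
  product measure.
\<close>

definition translate :: "'a \<Rightarrow> ('a set \<Rightarrow> bool) \<Rightarrow> 'a set \<Rightarrow> bool" where
  "translate g \<omega> = (\<lambda>e\<in>E. \<omega> ((\<otimes>) g ` e))"

lemma translate_edge: "g \<in> carrier G \<Longrightarrow> e \<in> E \<Longrightarrow> (\<otimes>) g ` e \<in> E"
proof -
  assume g: "g \<in> carrier G" and "e \<in> E"
  then obtain x s where x: "x \<in> carrier G" "s \<in> S" "e = {x, x \<otimes> s}" by (auto simp: E_eq)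
  then have "(\<otimes>) g ` e = {g \<otimes> x, g \<otimes> x \<otimes> s}" using g by (simp add: m_assoc)
  then show "(\<otimes>) g ` e \<in> E" using g x by simp
qed

lemma edge_subset: "e \<in> E \<Longrightarrow> e \<subseteq> carrier G"
  by (auto simp: E_eq)

lemma inj_on_translate_edges: "g \<in> carrier G \<Longrightarrow> inj_on (image ((\<otimes>) g)) E"
  by (rule inj_on_image, rule inj_on_subset[of _ "carrier G"]) (use edge_subset in \<open>auto simp: inj_on_def\<close>)

text \<open>
  Translation permutes independent coordinates with identical distributions.
\<close>

lemma distr_translate:
  assumes g: "g \<in> carrier G"
  shows "distr P P (translate g) = P"
  unfolding P_eq translate_def
  using distr_PiM_reindex[of E "\<lambda>_. measure_pmf (bernoulli_pmf p)" "image ((\<otimes>) g)" E]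
    inj_on_translate_edges[OF g] translate_edge[OF g] measure_pmf.prob_space_axioms
  by auto

lemma translate_measurable: "g \<in> carrier G \<Longrightarrow> translate g \<in> measurable P P"
  unfolding P_eq translate_def
  by (intro measurable_restrict measurable_component_singleton translate_edge)

lemma conn_translate:
  assumes "g \<in> carrier G" "x \<in> carrier G" "y \<in> carrier G"
  shows "(x, y) \<in> conn (translate g \<omega>) \<longleftrightarrow> (g \<otimes> x, g \<otimes> y) \<in> conn \<omega>"
proof -
  have "(\<forall>e\<in>set (path_edges x ws). translate g \<omega> e) \<longleftrightarrow> (\<forall>e\<in>set (path_edges (g \<otimes> x) ws). \<omega> e)"
    "x \<otimes> wprod ws = y \<longleftrightarrow> g \<otimes> x \<otimes> wprod ws = g \<otimes> y" if "ws \<in> lists S" for ws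
  proof -
    have ws: "set ws \<subseteq> S" "set ws \<subseteq> carrier G" using that words_carrier by (auto simp: lists_eq_set)
    then have "\<forall>e\<in>set (path_edges x ws). e \<in> E" using path_edges_in_E assms by blast
    then show "(\<forall>e\<in>set (path_edges x ws). translate g \<omega> e) \<longleftrightarrow> (\<forall>e\<in>set (path_edges (g \<otimes> x) ws). \<omega> e)"
      using path_edges_translate[OF assms(1,2) ws(2)] by (auto simp: translate_def)
    show "x \<otimes> wprod ws = y \<longleftrightarrow> g \<otimes> x \<otimes> wprod ws = g \<otimes> y"
      using assms ws(2) by (simp add: m_assoc)
  qed
  then show ?thesis using assms by (simp add: conn_iff_path)
qed

lemma infinite_cluster_translate:
  assumes "g \<in> carrier G" "x \<in> carrier G"
  shows "infinite (cluster (translate g \<omega>) x) \<longleftrightarrow> infinite (cluster \<omega> (g \<otimes> x))"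
proof -
  have "bij_betw ((\<otimes>) g) (cluster (translate g \<omega>) x) (cluster \<omega> (g \<otimes> x))"
    unfolding bij_betw_def
  proof
    show "inj_on ((\<otimes>) g) (cluster (translate g \<omega>) x)"
      using assms by (auto simp: inj_on_def cluster_def)
    show "(\<otimes>) g ` cluster (translate g \<omega>) x = cluster \<omega> (g \<otimes> x)"
    proof
      show "(\<otimes>) g ` cluster (translate g \<omega>) x \<subseteq> cluster \<omega> (g \<otimes> x)"
        using assms conn_translate by (auto simp: cluster_def)
      show "cluster \<omega> (g \<otimes> x) \<subseteq> (\<otimes>) g ` cluster (translate g \<omega>) x"
      proof
        fix y assume y: "y \<in> cluster \<omega> (g \<otimes> x)"
        then have yc: "y \<in> carrier G" and e: "y = g \<otimes> (inv g \<otimes> y)"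
          using assms by (auto simp: cluster_def m_assoc[symmetric])
        have "inv g \<otimes> y \<in> cluster (translate g \<omega>) x"
          using y e assms yc by (simp add: cluster_def conn_translate)
        then show "y \<in> (\<otimes>) g ` cluster (translate g \<omega>) x" using e by blast
      qed
    qed
  qed
  then show ?thesis by (auto dest: bij_betw_finite)
qed

lemma prob_infinite_cluster_translate:
  assumes g: "g \<in> carrier G" and B: "finite B" "B \<subseteq> carrier G"
  shows "prob {\<omega> \<in> space P. \<exists>x\<in>(\<otimes>) g ` B. infinite (cluster \<omega> x)}
       = prob {\<omega> \<in> space P. \<exists>x\<in>B. infinite (cluster \<omega> x)}"
proof -
  let ?J = "{\<omega> \<in> space P. \<exists>x\<in>B. infinite (cluster \<omega> x)}"
  have J: "?J \<in> events"
    using B pred_infinite_cluster by (auto simp: pred_def[symmetric] intro!: pred_intros_finite)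
  have "prob ?J = measure (distr P P (translate g)) ?J" by (simp add: distr_translate[OF g])
  also have "\<dots> = prob (translate g -` ?J \<inter> space P)"
    by (rule measure_distr[OF translate_measurable[OF g] J])
  also have "translate g -` ?J \<inter> space P = {\<omega> \<in> space P. \<exists>x\<in>(\<otimes>) g ` B. infinite (cluster \<omega> x)}"
    using measurable_space[OF translate_measurable[OF g]] infinite_cluster_translate[OF g] B(2)
    by (auto simp: subset_iff)
  finally show ?thesis by simp
qed

lemma exists_far_translate:
  assumes inf: "infinite (carrier G)" and B: "finite B" "B \<subseteq> carrier G"
  obtains g where "g \<in> carrier G"
    "\<And>x y m. x \<in> B \<Longrightarrow> y \<in> B \<Longrightarrow> m < N \<Longrightarrow> words S m (inv x \<otimes> (g \<otimes> y)) = {}"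
proof -
  define L where "L = (\<Union>m<N. {ws. set ws \<subseteq> S \<and> length ws = m})"
  have "finite L" unfolding L_def using finite_S by (auto simp: finite_lists_length_eq)
  define Z where "Z = (\<lambda>(x, ws, y). x \<otimes> wprod ws \<otimes> inv y) ` (B \<times> L \<times> B)"
  have "finite Z" unfolding Z_def using B \<open>finite L\<close> by auto
  then obtain g where g: "g \<in> carrier G" "g \<notin> Z" using inf by (meson finite_subset subsetI)
  have "words S m (inv x \<otimes> (g \<otimes> y)) = {}" if "x \<in> B" "y \<in> B" "m < N" for x y m
  proof (rule ccontr)
    assume "words S m (inv x \<otimes> (g \<otimes> y)) \<noteq> {}"
    then obtain ws where ws: "set ws \<subseteq> S" "length ws = m" "wprod ws = inv x \<otimes> (g \<otimes> y)"
      by (auto simp: words_def)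
    have xy: "x \<in> carrier G" "y \<in> carrier G" using that B by auto
    have "x \<otimes> (inv x \<otimes> (g \<otimes> y)) = g \<otimes> y" using xy g by (simp add: m_assoc[symmetric])
    moreover have "g \<otimes> y \<otimes> inv y = g" using xy g by (simp add: m_assoc)
    ultimately have "g = (\<lambda>(x, ws, y). x \<otimes> wprod ws \<otimes> inv y) (x, ws, y)" using ws(3) by simp
    moreover have "(x, ws, y) \<in> B \<times> L \<times> B" using that ws by (auto simp: L_def)
    ultimately have "g \<in> Z" unfolding Z_def by (rule image_eqI)
    with g(2) show False by contradiction
  qed
  with g(1) show ?thesis by (rule that)
qed

text \<open>
  Almost surely the infinite cluster meets some member of an exhausting sequence of finite sets, so one
  member \<open>B\<close> meets it with probability above 3/4. So does every translate, hence \<open>B\<close> and \<open>gB\<close> both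
  meet it with probability at least 1/2, and by uniqueness are then connected to each other. The union
  bound over pairs of vertices contradicts this when \<open>g\<close> is far away.
\<close>

lemma not_AE_unique_infinite_cluster:
  fixes c :: real
  assumes inf: "infinite (carrier G)"
    and bd: "conv_bound (indicator S) c" and c: "0 \<le> c" "p * c < 1"
  shows "\<not> (AE \<omega> in P. \<exists>!C. C \<in> cayley_clusters G S \<omega> \<and> infinite C)"
proof
  assume uniq: "AE \<omega> in P. \<exists>!C. C \<in> cayley_clusters G S \<omega> \<and> infinite C"
  define J where "J B = {\<omega> \<in> space P. \<exists>x\<in>B. infinite (cluster \<omega> x)}" for B
  have J_sets: "J B \<in> events" if "finite B" "B \<subseteq> carrier G" for B
    unfolding J_def using that pred_infinite_cluster by (auto simp: pred_def[symmetric] intro!: pred_intros_finite)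
  define b where "b n = from_nat_into (carrier G) ` {..<n}" for n :: nat
  have b: "finite (b n)" "b n \<subseteq> carrier G" for n
    unfolding b_def using from_nat_into[of "carrier G"] by auto
  have lim: "(\<lambda>n. prob (J (b n))) \<longlonglongrightarrow> prob (\<Union>n. J (b n))"
  proof (rule finite_Lim_measure_incseq)
    show "range (\<lambda>n. J (b n)) \<subseteq> events" using J_sets[OF b] by blast
    show "incseq (\<lambda>n. J (b n))" by (force simp: incseq_def J_def b_def)
  qed
  have "prob (\<Union>n. J (b n)) = 1"
  proof (rule prob_eq_1[THEN iffD2])
    show "(\<Union>n. J (b n)) \<in> events" by (rule sets.countable_UN) (use J_sets[OF b] in blast)
    show "AE \<omega> in P. \<omega> \<in> (\<Union>n. J (b n))"
      using uniq AE_space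
    proof eventually_elim
      fix \<omega> assume \<omega>: "\<exists>!C. C \<in> cayley_clusters G S \<omega> \<and> infinite C" "\<omega> \<in> space P"
      then obtain x where x: "x \<in> carrier G" "infinite (cluster \<omega> x)" by (auto simp: cayley_clusters_eq)
      obtain i where "x = from_nat_into (carrier G) i"
        using from_nat_into_surj[OF countable_carrier x(1)] by auto
      then have "x \<in> b (Suc i)" by (auto simp: b_def)
      then show "\<omega> \<in> (\<Union>n. J (b n))" using x(2) \<omega>(2) by (auto simp: J_def)
    qed
  qed
  with lim have "eventually (\<lambda>n. prob (J (b n)) > 3 / 4) sequentially"
    by (intro order_tendstoD(1)[where y = 1]) auto
  then obtain n where n: "prob (J (b n)) > 3 / 4" by (auto simp: eventually_sequentially)
  define B where "B = b n"
  have B: "finite B" "B \<subseteq> carrier G" using b by (auto simp: B_def)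
  define q where "q = p * c"
  have q: "0 \<le> q" "q < 1" using p01 c by (auto simp: q_def)
  have "(\<lambda>N. (card B)\<^sup>2 * (q ^ N / (1 - q))) \<longlonglongrightarrow> (card B)\<^sup>2 * (0 / (1 - q))"
    using q by (intro tendsto_intros LIMSEQ_realpow_zero) auto
  then have "eventually (\<lambda>N. (card B)\<^sup>2 * (q ^ N / (1 - q)) < 1 / 2) sequentially"
    by (intro order_tendstoD(2)[where y = "(card B)\<^sup>2 * (0 / (1 - q))"]) auto
  then obtain N where N: "(card B)\<^sup>2 * (q ^ N / (1 - q)) < 1 / 2" by (auto simp: eventually_sequentially)
  obtain g where g: "g \<in> carrier G"
    "\<And>x y m. x \<in> B \<Longrightarrow> y \<in> B \<Longrightarrow> m < N \<Longrightarrow> words S m (inv x \<otimes> (g \<otimes> y)) = {}"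
    using exists_far_translate[OF inf B, of N] by metis
  let ?gB = "(\<otimes>) g ` B"
  have gB: "finite ?gB" "?gB \<subseteq> carrier G" using B g(1) by auto
  have J2: "prob (J ?gB) > 3 / 4"
    using n prob_infinite_cluster_translate[OF g(1) B] by (simp add: J_def B_def)
  define K where "K x y = {\<omega> \<in> space P. (x, g \<otimes> y) \<in> conn \<omega>}" for x y
  have K_sets: "K x y \<in> events" if "x \<in> B" "y \<in> B" for x y
    unfolding K_def pred_def[symmetric] using that B g(1) by (intro pred_conn) auto
  have "AE \<omega> in P. \<omega> \<in> J B \<inter> J ?gB \<longrightarrow> \<omega> \<in> (\<Union>(x, y)\<in>B \<times> B. K x y)"
    using uniq
  proof eventually_elim
    fix \<omega> assume u: "\<exists>!C. C \<in> cayley_clusters G S \<omega> \<and> infinite C"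
    show "\<omega> \<in> J B \<inter> J ?gB \<longrightarrow> \<omega> \<in> (\<Union>(x, y)\<in>B \<times> B. K x y)"
    proof
      assume \<omega>: "\<omega> \<in> J B \<inter> J ?gB"
      then obtain x y where xy: "x \<in> B" "infinite (cluster \<omega> x)" "y \<in> B" "infinite (cluster \<omega> (g \<otimes> y))"
        by (auto simp: J_def)
      have carr: "x \<in> carrier G" "g \<otimes> y \<in> carrier G" using xy B g(1) by auto
      then have "cluster \<omega> x = cluster \<omega> (g \<otimes> y)"
        using u xy(2,4) unfolding cayley_clusters_eq by blast
      moreover have "g \<otimes> y \<in> cluster \<omega> (g \<otimes> y)" using carr by (simp add: cluster_def)
      ultimately have "g \<otimes> y \<in> cluster \<omega> x" by simp
      then have "(x, g \<otimes> y) \<in> conn \<omega>" by (simp add: cluster_def)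
      then show "\<omega> \<in> (\<Union>(x, y)\<in>B \<times> B. K x y)" using xy \<omega> by (auto simp: K_def J_def)
    qed
  qed
  then have "prob (J B \<inter> J ?gB) \<le> prob (\<Union>(x, y)\<in>B \<times> B. K x y)"
    by (rule finite_measure_mono_AE) (use K_sets B in auto)
  also have "\<dots> \<le> (\<Sum>z\<in>B \<times> B. prob (case z of (x, y) \<Rightarrow> K x y))"
    using K_sets B by (intro finite_measure_subadditive_finite) auto
  also have "\<dots> \<le> (\<Sum>z\<in>B \<times> B. q ^ N / (1 - q))"
  proof (intro sum_mono)
    fix z assume "z \<in> B \<times> B"
    then obtain x y where z: "z = (x, y)" "x \<in> B" "y \<in> B" by auto
    have "prob (K x y) \<le> q ^ N / (1 - q)"
      unfolding K_def q_def using z B g by (intro prob_conn_le[OF _ _ bd c]) auto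
    then show "prob (case z of (x, y) \<Rightarrow> K x y) \<le> q ^ N / (1 - q)" using z by simp
  qed
  also have "\<dots> = (card B)\<^sup>2 * (q ^ N / (1 - q))" by (simp add: card_cartesian_product power2_eq_square)
  finally have small: "prob (J B \<inter> J ?gB) < 1 / 2" using N by linarith
  have "prob (J B \<union> J ?gB) = prob (J B) + prob (J ?gB) - prob (J B \<inter> J ?gB)"
    using J_sets[OF B] J_sets[OF gB] by (simp add: finite_measure_Union' finite_measure_Diff' Int_commute)
  with small n J2 have "prob (J B \<union> J ?gB) > 1" by (simp add: B_def)
  then show False using prob_le_1 by (simp add: not_less[symmetric])
qed

end

section \<open>Comparing the two thresholds\<close>

context cayley_percolation
begin

text \<open>
  This provides a parameter for which there is a unique infinite cluster, so that the infimum defining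
  \<^const>\<open>p_u\<close> is over a nonempty set.
\<close>

lemma one_vertex_cluster_at_1:
  assumes "p = 1"
  shows "AE \<omega> in P. cayley_clusters G S \<omega> = {carrier G}"
proof -
  have "AE \<omega> in P. \<omega> e" if "e \<in> E" for e
  proof -
    have "prob {\<omega> \<in> space P. \<forall>e'\<in>{e}. \<omega> e'} = 1" using that assms by (subst prob_open) auto
    then have "prob {\<omega> \<in> space P. \<omega> e} = 1" by simp
    then show ?thesis
      using prob_Collect_eq_1[of "\<lambda>\<omega>. \<omega> e"] pred_open[OF that] by (simp add: pred_def)
  qed
  then have "AE \<omega> in P. \<forall>e\<in>E. \<omega> e" using countable_E by (simp add: AE_ball_countable)
  then show ?thesis
  proof eventually_elim
    fix \<omega> assume open_all: "\<forall>e\<in>E. \<omega> e"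
    have "cluster \<omega> x = carrier G" if x: "x \<in> carrier G" for x
    proof
      show "carrier G \<subseteq> cluster \<omega> x"
      proof
        fix y assume y: "y \<in> carrier G"
        have "inv x \<otimes> y \<in> carrier G" using x y by simp
        then have "inv x \<otimes> y \<in> wprod ` lists S"
          by (simp only: carrier_eq_wprod[OF S_carrier S_inv S_gen])
        then obtain ws where ws: "set ws \<subseteq> S" "wprod ws = inv x \<otimes> y" by (auto simp: lists_eq_set)
        have "(x, x \<otimes> wprod ws) \<in> conn \<omega>"
          using path_edges_in_E[OF x ws(1)] open_all by (intro conn_path x ws(1)) auto
        then show "y \<in> cluster \<omega> x" using x y ws(2) by (simp add: cluster_def m_assoc[symmetric])
      qed
    qed (auto simp: cluster_def)
    then show "cayley_clusters G S \<omega> = {carrier G}"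
      unfolding cayley_clusters_eq using one_closed by blast
  qed
qed

end

context group
begin

text \<open>
  The hypothesis on \<open>c\<close> places the Peierls threshold \<open>(4 * ln d + 2) / d\<close>, with \<open>d = card S\<close>, at
  most at \<open>1 / (2 * c)\<close>, because \<open>4 * ln d + 2 \<le> 4 * (1 + ln d)\<close>.
\<close>

lemma p_c_less_p_u_if_conv_bound:
  fixes c :: real
  assumes S: "finite_symmetric_generating_set G S" "\<one> \<notin> S" "S \<noteq> {}"
    and inf: "infinite (carrier G)"
    and bd: "conv_bound (indicator S) c" and c: "1 \<le> c"
    and small: "c * (1 + ln (card S)) \<le> card S / 8"
  shows "p_c G S < p_u G S"
proof -
  define d where "d = real (card S)"
  have Sprop: "finite S" "S \<subseteq> carrier G" "\<And>s. s \<in> S \<Longrightarrow> inv s \<in> S" "generate G S = carrier G"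
    using S(1) by (auto simp: finite_symmetric_generating_set_alt)
  have d: "d \<ge> 1" using S(3) Sprop(1) by (simp add: d_def Suc_le_eq card_gt_0_iff)
  then have ln_d: "0 \<le> ln d" by simp
  define q where "q = (4 * ln d + 2) / d"
  have "c * (4 * ln d + 2) \<le> c * (4 * (1 + ln d))" using c by (intro mult_left_mono) auto
  also have "\<dots> \<le> d / 2" using small by (simp add: d_def algebra_simps)
  finally have qc: "c * q \<le> 1 / 2" using d by (simp add: q_def divide_le_eq)
  have q0: "0 \<le> q" using ln_d d by (simp add: q_def)
  have "q * 1 \<le> q * c" using c q0 by (intro mult_left_mono)
  then have q1: "q \<le> 1" using qc by (simp add: mult.commute)
  have perc: "cayley_percolation G S p" if "0 \<le> p" "p \<le> 1" for p
    using that Sprop S(2) by unfold_locales auto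
  have "p_c G S \<le> q"
    unfolding p_c_def
  proof (rule cInf_lower)
    interpret cayley_percolation G S q by (rule perc[OF q0 q1])
    have "c * 1 \<le> c * (1 + ln d)" using c ln_d by (intro mult_left_mono) auto
    then have "c \<le> card S / 2" using small d by (simp add: d_def)
    moreover have "4 * ln (card S) + 2 \<le> q * card S" using d by (simp add: q_def d_def)
    ultimately show "q \<in> {p \<in> {0..1}. AE \<omega> in bernoulli_percolation (cayley_edges G S) p.
        \<exists>C. C \<in> cayley_clusters G S \<omega> \<and> infinite C}"
      using AE_infinite_cluster[OF bd S(3)] q0 q1 by simp
  qed (intro bdd_belowI[of _ 0], auto)
  also have "q < 1 / c"
  proof -
    have "c * q < 1" using qc by simp
    then show ?thesis using c by (simp add: less_divide_eq mult.commute)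
  qed
  also have "1 / c \<le> p_u G S"
    unfolding p_u_def
  proof (rule cInf_greatest)
    interpret cayley_percolation G S 1 by (rule perc) auto
    have "AE \<omega> in P. \<exists>!C. C \<in> cayley_clusters G S \<omega> \<and> infinite C"
      using one_vertex_cluster_at_1[OF refl] by eventually_elim (use inf in auto)
    then show "{p \<in> {0..1}. AE \<omega> in bernoulli_percolation (cayley_edges G S) p.
        \<exists>!C. C \<in> cayley_clusters G S \<omega> \<and> infinite C} \<noteq> {}"
      by (auto intro!: exI[of _ 1])
  next
    fix p assume p: "p \<in> {p \<in> {0..1}. AE \<omega> in bernoulli_percolation (cayley_edges G S) p.
        \<exists>!C. C \<in> cayley_clusters G S \<omega> \<and> infinite C}"
    then interpret cayley_percolation G S p by (intro perc) auto
    have "\<not> p * c < 1" using not_AE_unique_infinite_cluster[OF inf bd] c p by auto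
    then show "1 / c \<le> p" using c by (simp add: divide_le_eq)
  qed
  finally show ?thesis .
qed

text \<open>
  The whole carrier has no boundary, which the isoperimetric inequality forbids if it is finite.
\<close>

lemma infinite_carrier_if_not_amenable:
  assumes "\<not> amenable G"
  shows "infinite (carrier G)"
proof
  assume fin: "finite (carrier G)"
  have gen: "generate G (carrier G) = carrier G"
    using generate_incl[of "carrier G"] by (auto intro: generate.incl)
  obtain h :: real where h: "h > 0"
    "\<And>F. finite F \<Longrightarrow> F \<subseteq> carrier G \<Longrightarrow> h * card F \<le> card (out_pairs (carrier G) F)"
    using isoperimetric_if_not_amenable[OF fin _ gen _ assms] by auto
  have "out_pairs (carrier G) (carrier G) = {}" by (auto simp: out_pairs_def)
  then have "h * card (carrier G) \<le> 0" using h(2)[OF fin] by simp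
  moreover have "card (carrier G) > 0" using fin by (auto simp: card_gt_0_iff)
  ultimately show False using h(1) by (simp add: mult_le_0_iff)
qed

end

theorem corollary8:
  fixes G :: "('a, 'b) monoid_scheme"
  assumes "group G"
    and "finitely_generated G"
    and "\<not> amenable G"
  shows "\<exists>S. finite_symmetric_generating_set G S \<and> p_c G S < p_u G S"
proof -
  interpret group G by (rule assms(1))
  obtain S c where S: "finite_symmetric_generating_set G S" "\<one>\<^bsub>G\<^esub> \<notin> S" "S \<noteq> {}"
    "conv_bound (indicator S) c" "1 \<le> c" "c * (1 + ln (card S)) \<le> (1 / 8) * card S"
    using sparse_generating_set[OF assms(2,3), of "1 / 8"] by auto
  then have "p_c G S < p_u G S"
    using infinite_carrier_if_not_amenable[OF assms(3)] by (intro p_c_less_p_u_if_conv_bound) auto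
  with S(1) show ?thesis by blast
qed

end
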